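(* Consider $\dot{\vec{x}}=\vec{f}(\vec{x})+\epsilon\,\vec{g}(\vec{x},t)$ on $\Omega\subset\mathbb{R}^3$, with $0<\epsilon\ll 1$, under the standing assumptions listed in the context, where for $\epsilon=0$ the two-dimensional unstable manifold of $\vec a$ coincides with the two-dimensional stable manifold of $\vec b$, forming a heteroclinic manifold $\Gamma$ parametrized by $\bar{\vec x}(p,\alpha)$. Let $P^s,P^u,T^s,T^u$ be finite. Then for $(p,\alpha,t)\in[P^s,P^u]\times\mathrm{S}^1\times[T^s,T^u]$ the signed normal distance between the perturbed unstable and stable manifolds $$d(p,\alpha,\epsilon,t)=\frac{\vec{f}(\bar{\vec{x}}(p,\alpha))\wedge\bar{\vec{x}}_\alpha(p,\alpha)}{\left|\vec{f}(\bar{\vec{x}}(p,\alpha))\wedge\bar{\vec{x}}_\alpha(p,\alpha)\right|}\cdot\left[\vec{x}^{u}(p,\alpha,\epsilon,t)-\vec{x}^{s}(p,\alpha,\epsilon,t)\right]$$ can be expanded in $\epsilon$ in the form $$d(p,\alpha,\epsilon,t)=\epsilon\,\frac{M(p,\alpha,t)}{\left|\vec{f}(\bar{\vec{x}}(p,\alpha))\wedge\bar{\vec{x}}_\alpha(p,\alpha)\right|}+\mathcal{O}(\epsilon^2),$$ where the Melnikov function $M$ is the convergent improper integral $$M(p,\alpha,t)=\int_{-\infty}^{\infty}\exp\left[\int_{\tau}^p(\nabla\cdot\vec{f})(\bar{\vec{x}}(\xi,\alpha))\,\mathrm{d}\xi\right]\left[\vec{f}(\bar{\vec{x}}(\ta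u,\alpha))\wedge\bar{\vec{x}}_{\alpha}(\tau,\alpha)\right]\cdot\vec{g}(\bar{\vec{x}}(\tau,\alpha),\tau+t-p)\,\mathrm{d}\tau.$$
   Context: Here $\wedge$ is the cross product in $\mathbb{R}^3$, a subscript $\alpha$ denotes $\partial/\partial\alpha$, and $\mathrm{S}^1=[0,1)$ extended periodically with period $1$. $\mathcal{O}(\cdot)$ refers to $\epsilon\to0$. Standing assumptions. $\vec f:\Omega\to\mathbb{R}^3$ is $C^2$ with $D\vec f$ bounded on $\Omega$. For each $t\in\mathbb{R}$, $\vec g(\cdot,t)\in C^2(\Omega)$, and $\vec g$, $D\vec g$ (spatial derivative) are bounded on $\Omega\times\mathbb{R}$. $\vec a\ne\vec b$ are fixed points of $\dot{\vec x}=\vec f(\vec x)$; $D\vec f(\vec a)$ has one negative eigenvalue and two eigenvalues with positive real parts, $D\vec f(\vec b)$ has one positive eigenvalue and two eigenvalues with negative real parts, and in each case the eigenvectors associated with the two-dimensional (unstable, resp. stable) subspace are linearly independent. The two-dimensional unstable manifold of $\vec a$ and the two-dimensional stable manifold of $\vec b$ are $C^2$-smooth and coincide to form a two-dimensional orientable heteroclinic manifold $\Gamma$, a closed surface (together with $\vec a,\vec b$) separating an inside from an outside. Parametrization. $\Gamma$ is foliated by heteroclinic trajectories labelled by $\alpha\in\mathrm{S}^1$, with $p\in\mathbb{R}$ the time along the trajectory: $\partial_p\bar{\vec x}(p,\alpha)=\vec f(\bar{\vec x}(p,\alpha))$, $\lim_{p\to-\infty}\bar{\vec x}(p,\alpha)=\vec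 a$, $\lim_{p\to\infty}\bar{\vec x}(p,\alpha)=\vec b$. The parametrization $(p,\alpha)\in\mathbb{R}\times\mathrm{S}^1$ is $C^2$-smooth, and $\vec f(\bar{\vec x}(p,\alpha))\wedge\bar{\vec x}_\alpha(p,\alpha)$ is nonzero and points outward from $\Gamma$. Perturbed manifolds. For small $\epsilon$, $\vec a$ and $\vec b$ persist as hyperbolic trajectories $\vec a_\epsilon(t)$, $\vec b_\epsilon(t)$, $\mathcal{O}(\epsilon)$-close to $\vec a,\vec b$, with unstable manifold $\Gamma^u_\epsilon(\vec a_\epsilon,t)$ and stable manifold $\Gamma^s_\epsilon(\vec b_\epsilon,t)$ (time-slices at $t$). The points $\vec x^u(p,\alpha,\epsilon,t)\in\Gamma^u_\epsilon(\vec a_\epsilon,t)$ (for $p\le P^u$, $t\le T^u$) and $\vec x^s(p,\alpha,\epsilon,t)\in\Gamma^s_\epsilon(\vec b_\epsilon,t)$ (for $p\ge P^s$, $t\ge T^s$) are points $\mathcal{O}(\epsilon)$-close to $\bar{\vec x}(p,\alpha)$; more precisely, with $t$ and $(p,\alpha)$ fixed, the solutions of the perturbed equation $\tau\mapsto\vec x^{u}(p,\alpha,\epsilon,\tau)$ and $\tau\mapsto\vec x^{s}(p,\alpha,\epsilon,\tau)$ through these points lie on the respective perturbed manifolds and are within $K\epsilon$ of $\bar{\vec x}(\tau-t+p,\alpha)$ for all $\tau\in(-\infty,t]$, respectively all $\tau\in[t,\infty)$, with $K$ independent of $\tau$ and of $\epsilon\in[0,\epsilon_0]$ for some $\epsilon_0>0$.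 *)

theory Defs
  imports "HOL-Analysis.Analysis" "HOL-Library.Landau_Symbols"
begin

definition C2_on :: "('a::real_normed_vector \<Rightarrow> 'b::real_normed_vector) \<Rightarrow> 'a set \<Rightarrow> bool" where
  "C2_on f S \<longleftrightarrow>
     (\<exists>(f' :: 'a \<Rightarrow> 'a \<Rightarrow>\<^sub>L 'b) (f'' :: 'a \<Rightarrow> 'a \<Rightarrow>\<^sub>L 'a \<Rightarrow>\<^sub>L 'b).
        (\<forall>x\<in>S. (f has_derivative blinfun_apply (f' x)) (at x)) \<and>
        (\<forall>x\<in>S. (f' has_derivative blinfun_apply (f'' x)) (at x)) \<and>
        continuous_on S f'')"

definition divergence :: "(real^'n \<Rightarrow> real^'n) \<Rightarrow> real^'n \<Rightarrow> real" where
  "divergence f x = trace (jacobian f (at x))"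

definition eigenvector :: "complex^'n^'n \<Rightarrow> complex^'n \<Rightarrow> complex \<Rightarrow> bool" where
  "eigenvector A v k \<longleftrightarrow> v \<noteq> 0 \<and> A *v v = k *s v"

(* With v2, v3 independent, the three eigenvectors form a basis of C^3, so the eigenvalues
   listed are the whole spectrum with multiplicity (k2 = k3 is allowed). *)
definition one_neg_two_pos_spectrum :: "real^3^3 \<Rightarrow> bool" where
  "one_neg_two_pos_spectrum A \<longleftrightarrow>
     (\<exists>(k1::real) (k2::complex) (k3::complex) v1 v2 v3.
        k1 < 0 \<and> Re k2 > 0 \<and> Re k3 > 0 \<and>
        eigenvector (map_matrix complex_of_real A) v1 (complex_of_real k1) \<and>
        eigenvector (map_matrix complex_of_real A) v2 k2 \<and>
        eigenvector (map_matrix complex_of_real A) v3 k3 \<and>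
        v2 \<noteq> v3 \<and> vec.independent {v2, v3})"

definition one_pos_two_neg_spectrum :: "real^3^3 \<Rightarrow> bool" where
  "one_pos_two_neg_spectrum A \<longleftrightarrow>
     (\<exists>(k1::real) (k2::complex) (k3::complex) v1 v2 v3.
        k1 > 0 \<and> Re k2 < 0 \<and> Re k3 < 0 \<and>
        eigenvector (map_matrix complex_of_real A) v1 (complex_of_real k1) \<and>
        eigenvector (map_matrix complex_of_real A) v2 k2 \<and>
        eigenvector (map_matrix complex_of_real A) v3 k3 \<and>
        v2 \<noteq> v3 \<and> vec.independent {v2, v3})"

definition solves ::
  "('a::real_normed_vector \<Rightarrow> real \<Rightarrow> 'a) \<Rightarrow> 'a set \<Rightarrow> real set \<Rightarrow> (real \<Rightarrow> 'a) \<Rightarrow> bool" where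
  "solves F \<Omega> I y \<longleftrightarrow>
     (\<forall>t\<in>I. y t \<in> \<Omega> \<and> (y has_vector_derivative F (y t) t) (at t within I))"

(* Exponential dichotomy on the whole line of y' = A(t) y, with fundamental matrix X
   and projection P. *)
definition exp_dichotomy :: "(real \<Rightarrow> real^'n^'n) \<Rightarrow> bool" where
  "exp_dichotomy A \<longleftrightarrow>
     (\<exists>(X :: real \<Rightarrow> real^'n^'n) P C r. C > 0 \<and> r > 0 \<and> P ** P = P \<and>
        (\<forall>t. invertible (X t) \<and> (X has_vector_derivative A t ** X t) (at t)) \<and>
        (\<forall>s t. s \<le> t \<longrightarrow>
           norm (X t ** P ** matrix_inv (X s)) \<le> C * exp (- r * (t - s))) \<and>
        (\<forall>s t. t \<le> s \<longrightarrow>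
           norm (X t ** (mat 1 - P) ** matrix_inv (X s)) \<le> C * exp (- r * (s - t))))"

definition hyperbolic_trajectory ::
  "(real^'n \<Rightarrow> real \<Rightarrow> real^'n) \<Rightarrow> (real^'n) set \<Rightarrow> (real \<Rightarrow> real^'n) \<Rightarrow> bool" where
  "hyperbolic_trajectory F \<Omega> c \<longleftrightarrow>
     solves F \<Omega> UNIV c \<and> exp_dichotomy (\<lambda>t. jacobian (\<lambda>x. F x t) (at (c t)))"

definition unstable_slice ::
  "('a::real_normed_vector \<Rightarrow> real \<Rightarrow> 'a) \<Rightarrow> 'a set \<Rightarrow> (real \<Rightarrow> 'a) \<Rightarrow> real \<Rightarrow> 'a set" where
  "unstable_slice F \<Omega> c t =
     {x. \<exists>y. solves F \<Omega> {..t} y \<and> y t = x \<and> ((\<lambda>s. y s - c s) \<longlongrightarrow> 0) at_bot}"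

definition stable_slice ::
  "('a::real_normed_vector \<Rightarrow> real \<Rightarrow> 'a) \<Rightarrow> 'a set \<Rightarrow> (real \<Rightarrow> 'a) \<Rightarrow> real \<Rightarrow> 'a set" where
  "stable_slice F \<Omega> c t =
     {x. \<exists>y. solves F \<Omega> {t..} y \<and> y t = x \<and> ((\<lambda>s. y s - c s) \<longlongrightarrow> 0) at_top}"

(* For an autonomous field all time slices agree, so the one at time 0 is used. *)
definition unstable_manifold :: "('a::real_normed_vector \<Rightarrow> 'a) \<Rightarrow> 'a set \<Rightarrow> 'a \<Rightarrow> 'a set" where
  "unstable_manifold f \<Omega> a = unstable_slice (\<lambda>x t. f x) \<Omega> (\<lambda>t. a) 0"

definition stable_manifold :: "('a::real_normed_vector \<Rightarrow> 'a) \<Rightarrow> 'a set \<Rightarrow> 'a \<Rightarrow> 'a set" where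
  "stable_manifold f \<Omega> b = stable_slice (\<lambda>x t. f x) \<Omega> (\<lambda>t. b) 0"

definition perturbed ::
  "('a::real_vector \<Rightarrow> 'a) \<Rightarrow> ('a \<Rightarrow> real \<Rightarrow> 'a) \<Rightarrow> real \<Rightarrow> 'a \<Rightarrow> real \<Rightarrow> 'a" where
  "perturbed f g \<epsilon> x t = f x + \<epsilon> *\<^sub>R g x t"

definition C2_chart :: "(real^3) set \<Rightarrow> (real^2) set \<Rightarrow> (real^2 \<Rightarrow> real^3) \<Rightarrow> bool" where
  "C2_chart S V \<phi> \<longleftrightarrow>
     open V \<and> C2_on \<phi> V \<and> (\<forall>v\<in>V. inj (frechet_derivative \<phi> (at v))) \<and>
     openin (top_of_set S) (\<phi> ` V) \<and> (\<exists>\<psi>. homeomorphism V (\<phi> ` V) \<phi> \<psi>)"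

definition C2_surface :: "(real^3) set \<Rightarrow> bool" where
  "C2_surface S \<longleftrightarrow> (\<forall>x\<in>S. \<exists>V \<phi>. C2_chart S V \<phi> \<and> x \<in> \<phi> ` V)"

(* Orientability of a surface in three-space: existence of a continuous unit normal field. *)
definition orientable_surface :: "(real^3) set \<Rightarrow> bool" where
  "orientable_surface S \<longleftrightarrow>
     (\<exists>\<nu> :: real^3 \<Rightarrow> real^3. continuous_on S \<nu> \<and> (\<forall>x\<in>S. norm (\<nu> x) = 1) \<and>
        (\<forall>V \<phi>. C2_chart S V \<phi> \<longrightarrow>
           (\<forall>v\<in>V. \<forall>h. \<nu> (\<phi> v) \<bullet> frechet_derivative \<phi> (at v) h = 0)))"

definition closed_surface :: "(real^3) set \<Rightarrow> bool" where
  "closed_surface S \<longleftrightarrow> C2_surface S \<and> compact S \<and> connected S"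

definition points_outward :: "(real^3) set \<Rightarrow> real^3 \<Rightarrow> real^3 \<Rightarrow> bool" where
  "points_outward S x n \<longleftrightarrow>
     (\<exists>\<delta>>0. \<forall>h. 0 < h \<and> h < \<delta> \<longrightarrow>
        x + h *\<^sub>R n \<in> outside S \<and> x - h *\<^sub>R n \<in> inside S)"

(* The manifold is parametrized by xbar p \<alpha>, with \<alpha> in the circle [0,1) extended
   1-periodically to the reals. *)
definition surface_normal ::
  "(real^3 \<Rightarrow> real^3) \<Rightarrow> (real \<Rightarrow> real \<Rightarrow> real^3) \<Rightarrow> real \<Rightarrow> real \<Rightarrow> real^3" where
  "surface_normal f xbar p \<alpha> =
     cross3 (f (xbar p \<alpha>)) (vector_derivative (\<lambda>\<beta>. xbar p \<beta>) (at \<alpha>))"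

definition normal_distance ::
  "(real^3 \<Rightarrow> real^3) \<Rightarrow> (real \<Rightarrow> real \<Rightarrow> real^3) \<Rightarrow>
   (real \<Rightarrow> real \<Rightarrow> real \<Rightarrow> real \<Rightarrow> real^3) \<Rightarrow> (real \<Rightarrow> real \<Rightarrow> real \<Rightarrow> real \<Rightarrow> real^3) \<Rightarrow>
   real \<Rightarrow> real \<Rightarrow> real \<Rightarrow> real \<Rightarrow> real" where
  "normal_distance f xbar xu xs p \<alpha> \<epsilon> t =
     (surface_normal f xbar p \<alpha> /\<^sub>R norm (surface_normal f xbar p \<alpha>)) \<bullet>
     (xu p \<alpha> \<epsilon> t - xs p \<alpha> \<epsilon> t)"

(* The inner interval integral is oriented: it changes sign when \<tau> > p. *)
definition melnikov_integrand ::
  "(real^3 \<Rightarrow> real^3) \<Rightarrow> (real^3 \<Rightarrow> real \<Rightarrow> real^3) \<Rightarrow> (real \<Rightarrow> real \<Rightarrow> real^3) \<Rightarrow>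
   real \<Rightarrow> real \<Rightarrow> real \<Rightarrow> real \<Rightarrow> real" where
  "melnikov_integrand f g xbar p \<alpha> t \<tau> =
     exp (LBINT \<xi>=\<tau>..p. divergence f (xbar \<xi> \<alpha>)) *
     (surface_normal f xbar \<tau> \<alpha> \<bullet> g (xbar \<tau> \<alpha>) (\<tau> + t - p))"

(* The gauge integral over the whole line: by Hake's theorem it exists exactly when the
   improper integral converges at both ends, and then has the same value. *)
definition melnikov ::
  "(real^3 \<Rightarrow> real^3) \<Rightarrow> (real^3 \<Rightarrow> real \<Rightarrow> real^3) \<Rightarrow> (real \<Rightarrow> real \<Rightarrow> real^3) \<Rightarrow>
   real \<Rightarrow> real \<Rightarrow> real \<Rightarrow> real" where
  "melnikov f g xbar p \<alpha> t = integral UNIV (melnikov_integrand f g xbar p \<alpha> t)"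

end

(* Let N = f x xbar_alpha and let V(s) be N(s) times the exponential of the integral of div f from s
   to p. Then V solves the adjoint variational equation V' = -Df^T V, so for a perturbed orbit Y
   staying K*eps-close to xbar one has (V . (Y - xbar))' = eps V . g + O(eps^2) |V|. Integrating over the two
   half-lines and subtracting gives the expansion, provided |V| decays exponentially at both ends.

   The decay at -infinity: Gamma is a compact surface, so invariance of domain makes xbar a homeomorphism onto
   its image and forces xbar(s, alpha) -> a uniformly in alpha. Differences of orbits then stay close to a for
   all negative times, and a cone argument confines the tangent planes of Gamma to ever narrower cones
   around the unstable eigenspace of Df(a). So V aligns with the left eigenvector of the negative
   eigenvalue, along which the adjoint equation contracts backward in time. The end +infinity follows by
   time reversal. *)
theory Submission
  imports Defs
begin

subsection \<open>Saddles with a two-dimensional unstable space\<close>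

text \<open>The manifolds are known only as sets of orbits with a given limit, so tangency of
  \<Gamma> to the eigenspaces at the fixed points has to be derived, and the decay of V cannot be
  read off from its formula: xbar_\<alpha> may be unbounded. Uniformity in \<alpha> lets two orbits
  with different labels be compared inside one small ball for all earlier times; a difference
  dominated by its contracting component would have to grow backward in time, which boundedness
  forbids. Cones are measured by squared moduli of left eigenfunctionals, which treats real and
  complex pairs of eigenvalues alike. The field \<open>g\<close> carries no regularity in time, so
  even local integrability of the integrand has to come from the perturbed solutions. Over a
  half-line the boundary term at infinity vanishes because V decays while Y - xbar is at most K*eps;
  the same decay makes the Melnikov integral converge. At the finite end the weight is 1 and V is
  the surface normal itself.\<close>

lemma saddle_left_eigenbasis:
  fixes A :: "real^3^3"
  assumes "one_neg_two_pos_spectrum A"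
  obtains k :: "3 \<Rightarrow> complex" and w :: "3 \<Rightarrow> real^3 \<Rightarrow> complex"
  where "Re (k 1) < 0" "Im (k 1) = 0" "Re (k 2) > 0" "Re (k 3) > 0"
    "\<And>j. linear (w j)" "\<And>j d. w j (A *v d) = k j * w j d"
    "\<And>d. \<forall>j. w j d = 0 \<Longrightarrow> d = 0" "\<exists>d. w 1 d \<noteq> 0"
proof -
  let ?A = "map_matrix complex_of_real A"
  obtain k1 k2 k3 v1 v2 v3 where k: "k1 < 0" "Re k2 > 0" "Re k3 > 0"
    and ev: "eigenvector ?A v1 (complex_of_real k1)" "eigenvector ?A v2 k2" "eigenvector ?A v3 k3"
    and ind: "v2 \<noteq> v3" "vec.independent {v2, v3}"
    using assms unfolding one_neg_two_pos_spectrum_def by blast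
  define k where "k j = (if j = 1 then complex_of_real k1 else if j = 2 then k2 else k3)" for j :: 3
  define v where "v j = (if j = 1 then v1 else if j = 2 then v2 else v3)" for j :: 3
  have ne: "(1::3) \<noteq> 2" "(1::3) \<noteq> 3" "(2::3) \<noteq> 3" "(2::3) \<noteq> 1" "(3::3) \<noteq> 1" "(3::3) \<noteq> 2" by simp_all
  define P :: "complex^3^3" where "P = (\<chi> i j. v j $ i)"
  have Pv: "P *v x = (x$1) *s v1 + (x$2) *s v2 + (x$3) *s v3" for x
    by (simp add: P_def matrix_vector_mult_def vec_eq_iff sum_3 v_def ne algebra_simps)
  have ev': "?A *v v1 = complex_of_real k1 *s v1" "?A *v v2 = k2 *s v2" "?A *v v3 = k3 *s v3"
    "v1 \<noteq> 0"
    using ev unfolding eigenvector_def by auto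
  have APv: "?A *v (P *v x) = (k1 * x$1) *s v1 + (k2 * x$2) *s v2 + (k3 * x$3) *s v3" for x
    unfolding Pv by (simp add: matrix_vector_right_distrib vector_scalar_commute ev' vector_smult_assoc mult.commute)
  have ind': "c = 0 \<and> d = 0" if eq: "c *s v2 + d *s v3 = 0" for c d
  proof -
    have 1: "u v2 = 0 \<and> u v3 = 0" if "(\<Sum>x\<in>{v2,v3}. u x *s x) = 0" for u
      using ind that vec.independent_explicit_finite_subsets[of "{v2,v3}"] by blast
    have "(\<Sum>x\<in>{v2,v3}. (if x = v2 then c else d) *s x) = 0"
      using eq ind(1) by auto
    from 1[OF this] show ?thesis using ind(1) by auto
  qed
  \<comment> \<open>Subtracting \<open>k1\<close> times \<open>P *v x\<close> from its image under
    \<open>A\<close> removes \<open>v1\<close> and leaves a combination of \<open>v2\<close> and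
    \<open>v3\<close>. The factors \<open>k2 - k1\<close> and \<open>k3 - k1\<close> cannot vanish,
    since the real parts have opposite signs.\<close>
  have inj: "x = 0" if "P *v x = 0" for x
  proof -
    have a: "(x$1) *s v1 + (x$2) *s v2 + (x$3) *s v3 = 0" using that Pv by simp
    have b: "(k1 * x$1) *s v1 + (k2 * x$2) *s v2 + (k3 * x$3) *s v3 = 0" using that APv[of x] by simp
    have "((k2 - k1) * x$2) *s v2 + ((k3 - k1) * x$3) *s v3
       = ((k1 * x$1) *s v1 + (k2 * x$2) *s v2 + (k3 * x$3) *s v3)
         - k1 *s ((x$1) *s v1 + (x$2) *s v2 + (x$3) *s v3)"
      by (simp add: vec_eq_iff algebra_simps)
    also have "\<dots> = 0" using a b by simp
    finally have "(k2 - k1) * x$2 = 0 \<and> (k3 - k1) * x$3 = 0" by (rule ind')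
    moreover have "k2 - k1 \<noteq> 0" "k3 - k1 \<noteq> 0" using k by (auto simp: complex_eq_iff)
    ultimately have "x$2 = 0" "x$3 = 0" by auto
    moreover from this a have "x$1 = 0" using ev'(4) by (auto simp: vec_eq_iff)
    ultimately show ?thesis by (simp add: vec_eq_iff forall_3)
  qed
  then obtain M where M: "M ** P = mat 1" using matrix_left_invertible_ker[of P] by auto
  then have PM: "P ** M = mat 1" by (simp add: matrix_left_right_inverse)
  \<comment> \<open>The rows of \<open>M\<close>, the inverse of the eigenvector matrix
    \<open>P\<close>, are left eigenvectors of \<open>A\<close>; here they act on real vectors, with
    complex values.\<close>
  define w where "w j d = (M *v (\<chi> i. complex_of_real (d$i))) $ j" for j and d :: "real^3"
  have lin: "linear (w j)" for j
    unfolding w_def by (rule linearI)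
      (simp_all add: matrix_vector_mult_def sum_3 algebra_simps scaleR_conv_of_real[where 'a=complex])
  have MA: "(M *v (?A *v x)) $ j = k j * (M *v x) $ j" for x j
  proof -
    define y where "y = M *v x"
    have x: "x = P *v y" unfolding y_def by (simp add: matrix_vector_mul_assoc PM)
    have "?A *v x = P *v (\<chi> j. k j * y $ j)"
      unfolding x APv by (simp add: Pv k_def ne)
    then have "M *v (?A *v x) = (\<chi> j. k j * y $ j)"
      by (simp add: matrix_vector_mul_assoc M)
    then show ?thesis by (simp add: y_def)
  qed
  have cA: "(\<chi> i. complex_of_real ((A *v d)$i)) = ?A *v (\<chi> i. complex_of_real (d$i))" for d
    by (simp add: matrix_vector_mult_def map_matrix_def vec_eq_iff sum_3)
  have wA: "w j (A *v d) = k j * w j d" for j d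
    unfolding w_def cA by (rule MA)
  have winj: "d = 0" if "\<And>j. w j d = 0" for d
  proof -
    let ?x = "\<chi> i. complex_of_real (d$i)"
    have "M *v ?x = 0" using that by (simp add: w_def vec_eq_iff)
    then have "P *v (M *v ?x) = 0" by simp
    then have "?x = 0" by (simp add: matrix_vector_mul_assoc PM)
    then show ?thesis by (simp add: vec_eq_iff)
  qed
  \<comment> \<open>A row vanishing on the real unit vectors is zero, which contradicts
    \<open>M ** P = mat 1\<close>.\<close>
  have wne: "\<exists>d. w 1 d \<noteq> 0"
  proof (rule ccontr)
    assume "\<not> ?thesis"
    then have *: "w 1 d = 0" for d by auto
    have "M $ 1 $ i = 0" for i
      using *[of "axis i 1"] by (simp add: w_def matrix_vector_mult_def axis_def if_distrib[of "\<lambda>x. _ * complex_of_real x"] cong: if_cong)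
    then have "(M ** P) $ 1 $ 1 = 0" by (simp add: matrix_matrix_mult_def)
    then show False using M by (simp add: mat_def)
  qed
  show ?thesis
    by (rule that[of k w]) (use k lin wA winj wne in \<open>auto simp: k_def\<close>)
qed

lemma bounded_bilinear_inner_linear:
  fixes w :: "'a::euclidean_space \<Rightarrow> 'b::euclidean_space"
  assumes "linear w"
  shows "bounded_bilinear (\<lambda>x y. w x \<bullet> w y)"
  using bounded_bilinear.comp[OF bounded_bilinear_inner linear_conv_bounded_linear[THEN iffD1, OF assms]
      linear_conv_bounded_linear[THEN iffD1, OF assms]] .

text \<open>\<open>S\<close> is the polarized squared modulus of the left eigenfunctional for the
  negative eigenvalue, \<open>U\<close> the sum of those for the other two. Along x' = A x,
  \<open>S\<close> evolves at the exact rate \<open>2 * k\<close> and \<open>U\<close> grows at a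
  rate of at least \<open>2 * \<mu>\<close>, which is what a cone argument needs. \<open>l\<close>
  is a real left eigenvector dominated by \<open>S\<close>.\<close>

lemma saddle_forms:
  fixes A :: "real^3^3"
  assumes "one_neg_two_pos_spectrum A"
  obtains k \<mu> c :: real and l :: "real^3" and S U :: "real^3 \<Rightarrow> real^3 \<Rightarrow> real"
  where "k < 0" "\<mu> > 0" "c > 0" "l \<noteq> 0" "\<And>d. l \<bullet> (A *v d) = k * (l \<bullet> d)"
    "bounded_bilinear S" "bounded_bilinear U" "\<And>x y. S x y = S y x" "\<And>x y. U x y = U y x"
    "\<And>d. S d (A *v d) = k * S d d" "\<And>d. \<mu> * U d d \<le> U d (A *v d)"
    "\<And>d. 0 \<le> U d d" "\<And>d. (l \<bullet> d)\<^sup>2 \<le> S d d" "\<And>d. c * (norm d)\<^sup>2 \<le> S d d + U d d"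
proof -
  obtain k :: "3 \<Rightarrow> complex" and w :: "3 \<Rightarrow> real^3 \<Rightarrow> complex" where k: "Re (k 1) < 0" "Im (k 1) = 0" "Re (k 2) > 0" "Re (k 3) > 0"
    and lin: "\<And>j. linear (w j)" and wA: "\<And>j d. w j (A *v d) = k j * w j d"
    and inj: "\<And>d. \<forall>j. w j d = 0 \<Longrightarrow> d = 0" and ne: "\<exists>d. w 1 d \<noteq> 0"
    by (rule saddle_left_eigenbasis[OF assms]) blast
  define S where "S x y = w 1 x \<bullet> w 1 y" for x y
  define U where "U x y = w 2 x \<bullet> w 2 y + w 3 x \<bullet> w 3 y" for x y
  \<comment> \<open>In the real inner product of complex numbers the imaginary part of
    \<open>q\<close> contributes only a vector orthogonal to \<open>z\<close>.\<close>
  have in_mult: "z \<bullet> (q * z) = Re q * (z \<bullet> z)" for z q :: complex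
    by (simp add: inner_complex_def algebra_simps)
  define \<mu> where "\<mu> = min (Re (k 2)) (Re (k 3))"
  define W :: "real^3 \<Rightarrow> complex^3" where "W d = (\<chi> j. w j d)" for d
  have linW: "linear W"
    using lin by (intro linearI) (auto simp: W_def vec_eq_iff linear_iff)
  have "inj W"
    using linear_injective_0[OF linW] inj by (auto simp: W_def vec_eq_iff)
  then obtain C where C: "C > 0" "\<And>d. C * norm d \<le> norm (W d)"
    using linear_inj_bounded_below_pos[OF linW] by metis
  have normW: "(norm (W d))\<^sup>2 = S d d + U d d" for d
    by (simp add: W_def S_def U_def power2_norm_eq_inner inner_vec_def sum_3)
  \<comment> \<open>The functional \<open>w 1\<close> may be complex valued. As \<open>k 1\<close>
    is real, the real and the imaginary part of \<open>w 1\<close> each satisfy the eigenvalue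
    relation, and one of them is nonzero.\<close>
  have "\<exists>h::complex \<Rightarrow> real. linear h \<and> (\<exists>d. h (w 1 d) \<noteq> 0) \<and> (\<forall>z. (h z)\<^sup>2 \<le> z \<bullet> z) \<and> (\<forall>z. h (k 1 * z) = Re (k 1) * h z)"
  proof (cases "\<exists>d. Re (w 1 d) \<noteq> 0")
    case True
    then show ?thesis using k(2)
      by (intro exI[of _ Re]) (auto simp: inner_complex_def power2_eq_square bounded_linear.linear[OF bounded_linear_Re])
  next
    case False
    then show ?thesis using k(2) ne
      by (intro exI[of _ Im]) (auto simp: inner_complex_def power2_eq_square complex_eq_iff bounded_linear.linear[OF bounded_linear_Im])
  qed
  then obtain h :: "complex \<Rightarrow> real" where h: "linear h" "\<exists>d. h (w 1 d) \<noteq> 0"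
    "\<And>z. (h z)\<^sup>2 \<le> z \<bullet> z" "\<And>z. h (k 1 * z) = Re (k 1) * h z" by blast
  define l where "l = adjoint (h \<circ> w 1) 1"
  have l: "l \<bullet> d = h (w 1 d)" for d
    using adjoint_works[OF linear_compose[OF lin[of 1] h(1)], of d 1]
    by (simp add: l_def inner_commute)
  have "l \<noteq> 0" using h(2) l by auto
  have "bounded_bilinear S"
    unfolding S_def by (rule bounded_bilinear_inner_linear[OF lin])
  moreover have "bounded_bilinear (\<lambda>x y. U x y)"
  proof -
    have "linear (\<lambda>x. (w 2 x, w 3 x))" using lin by (auto simp: linear_iff)
    from bounded_bilinear_inner_linear[OF this] show ?thesis by (simp add: U_def inner_prod_def)
  qed
  moreover have "\<mu> * U d d \<le> U d (A *v d)" for d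
    unfolding U_def wA in_mult by (simp add: distrib_left \<mu>_def add_mono mult_right_mono)
  moreover have "C\<^sup>2 * (norm d)\<^sup>2 \<le> S d d + U d d" for d
    unfolding normW[symmetric] power_mult_distrib[symmetric]
    using C by (intro power_mono) auto
  moreover have "0 < \<mu>" "0 < C\<^sup>2" using k C(1) by (auto simp: \<mu>_def)
  moreover have "l \<bullet> (A *v d) = Re (k 1) * (l \<bullet> d)" "(l \<bullet> d)\<^sup>2 \<le> S d d" for d
    unfolding l wA S_def by (rule h)+
  moreover have "S x y = S y x" "U x y = U y x" "0 \<le> U x x" for x y
    by (simp_all add: S_def U_def inner_commute)
  moreover have "S d (A *v d) = Re (k 1) * S d d" for d
    by (simp add: S_def wA in_mult)
  ultimately show ?thesis
    using \<open>l \<noteq> 0\<close> k(1) that[of "Re (k 1)" \<mu> "C\<^sup>2" l S U] by blast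
qed

subsection \<open>Tangent planes along orbits leaving the saddle\<close>

lemma periodic_int:
  fixes X :: "real \<Rightarrow> 'a"
  assumes "\<And>\<alpha>. X (\<alpha> + 1) = X \<alpha>"
  shows "X (\<alpha> + of_int n) = X \<alpha>"
proof -
  have nat: "X (\<alpha> + real m) = X \<alpha>" for m \<alpha>
    by (induction m) (simp, metis add.assoc add.commute assms of_nat_Suc)
  show ?thesis
  proof (cases "n \<ge> 0")
    case True
    then show ?thesis using nat[of \<alpha> "nat n"] by simp
  next
    case False
    then show ?thesis using nat[of "\<alpha> + of_int n" "nat (- n)"] by simp
  qed
qed

text \<open>Labels of equal points differ by an integer, so closer than 1 they coincide. This makes
  the periodic extension injective on strips of width 1 centred anywhere, in particular across the
  seam \<alpha> = 0.\<close>

lemma cylinder_injective: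
  fixes X :: "real \<Rightarrow> real \<Rightarrow> 'a"
  assumes per: "\<And>s \<alpha>. X s (\<alpha> + 1) = X s \<alpha>"
    and inj: "inj_on (\<lambda>(s, \<alpha>). X s \<alpha>) (UNIV \<times> {0..<1})"
    and eq: "X s \<alpha> = X s' \<alpha>'"
  shows "s = s'" and "\<bar>\<alpha> - \<alpha>'\<bar> < 1 \<Longrightarrow> \<alpha> = \<alpha>'"
proof -
  have "X s (frac \<alpha>) = X s \<alpha>" for s \<alpha>
    using periodic_int[of "X s" "frac \<alpha>" "\<lfloor>\<alpha>\<rfloor>", OF per] by (simp add: frac_def)
  then have "X s (frac \<alpha>) = X s' (frac \<alpha>')" using eq by simp
  then have *: "s = s'" "frac \<alpha> = frac \<alpha>'"
    using inj_onD[OF inj, of "(s, frac \<alpha>)" "(s', frac \<alpha>')"] by (auto simp: frac_ge_0 frac_lt_1)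
  show "s = s'" by fact
  assume "\<bar>\<alpha> - \<alpha>'\<bar> < 1"
  moreover have d: "\<alpha> - \<alpha>' = of_int (\<lfloor>\<alpha>\<rfloor> - \<lfloor>\<alpha>'\<rfloor>)" using *(2) by (simp add: frac_def)
  ultimately have "\<bar>\<lfloor>\<alpha>\<rfloor> - \<lfloor>\<alpha>'\<rfloor>\<bar> < 1"
    by (simp only: of_int_abs[symmetric] of_int_less_1_iff)
  then show "\<alpha> = \<alpha>'" using d by simp
qed

lemma cylinder_image_range:
  fixes X :: "real \<Rightarrow> real \<Rightarrow> 'a"
  assumes per: "\<And>s \<alpha>. X s (\<alpha> + 1) = X s \<alpha>"
    and bij: "bij_betw (\<lambda>(s, \<alpha>). X s \<alpha>) (UNIV \<times> {0..<1}) T"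
  shows "X s \<alpha> \<in> T"
proof -
  have "X s (frac \<alpha>) = X s \<alpha>"
    using periodic_int[of "X s" "frac \<alpha>" "\<lfloor>\<alpha>\<rfloor>", OF per] by (simp add: frac_def)
  moreover have "(\<lambda>(s, \<alpha>). X s \<alpha>) (s, frac \<alpha>) \<in> T"
    using bij by (intro bij_betw_apply[OF bij]) (auto simp: frac_ge_0 frac_lt_1)
  ultimately show ?thesis by simp
qed

text \<open>Read in a chart, the parametrization near (\<sigma>, \<beta>) is a continuous injection
  between planes, so a small open set of parameters covers a relatively open set \<open>T\<close> of
  \<Gamma>. Global injectivity then prevents every orbit from meeting \<open>T\<close> at a time
  outside the chosen time range.\<close>

lemma cylinder_local_return_bound:
  fixes X :: "real \<Rightarrow> real \<Rightarrow> real^3"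
  assumes surf: "C2_surface \<Gamma>"
    and cont: "continuous_on UNIV (\<lambda>(s, \<alpha>). X s \<alpha>)"
    and per: "\<And>s \<alpha>. X s (\<alpha> + 1) = X s \<alpha>"
    and bij: "bij_betw (\<lambda>(s, \<alpha>). X s \<alpha>) (UNIV \<times> {0..<1}) (\<Gamma> - E)"
  obtains T where "openin (top_of_set \<Gamma>) T" "X \<sigma> \<beta> \<in> T" "\<And>s \<alpha>. X s \<alpha> \<in> T \<Longrightarrow> \<sigma> - 1 < s"
proof -
  let ?X = "\<lambda>z. X (fst z) (snd z)"
  have X\<Gamma>: "X s \<alpha> \<in> \<Gamma>" for s \<alpha>
    using cylinder_image_range[OF per bij] by blast
  have inj: "inj_on (\<lambda>(s, \<alpha>). X s \<alpha>) (UNIV \<times> {0..<1})" using bij by (rule bij_betw_imp_inj_on)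
  have cont': "continuous_on A ?X" for A
    using continuous_on_subset[OF cont, of A] by (simp add: case_prod_unfold)
  obtain V \<phi> where chart: "C2_chart \<Gamma> V \<phi>" and q: "X \<sigma> \<beta> \<in> \<phi> ` V"
    using surf X\<Gamma>[of \<sigma> \<beta>] unfolding C2_surface_def by blast
  obtain \<psi> where V: "open V" "openin (top_of_set \<Gamma>) (\<phi> ` V)" "homeomorphism V (\<phi> ` V) \<phi> \<psi>"
    using chart unfolding C2_chart_def by auto
  obtain O' where O': "open O'" "\<phi> ` V = \<Gamma> \<inter> O'"
    using V(2) unfolding openin_open by blast
  \<comment> \<open>The label range has length 1, so \<open>X\<close> is injective on it; the time
    range yields the \<open>\<sigma> - 1\<close> of the conclusion. The preimage of
    \<open>O'\<close> keeps the image inside the chart.\<close>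
  define W where "W = {\<sigma> - 1<..<\<sigma> + 1} \<times> {\<beta> - 1/2<..<\<beta> + 1/2} \<inter> ?X -` O'"
  have W: "open W"
    unfolding W_def using O'(1) cont'[of UNIV] by (intro open_Int open_Times open_vimage) auto
  have XW: "?X ` W \<subseteq> \<phi> ` V" unfolding O'(2) W_def using X\<Gamma> by auto
  have injX: "inj_on ?X W"
  proof (rule inj_onI)
    fix z z' assume z: "z \<in> W" "z' \<in> W" and eq: "?X z = ?X z'"
    have "\<bar>snd z - snd z'\<bar> < 1" using z unfolding W_def by (auto simp: abs_if)
    then show "z = z'"
      using cylinder_injective[OF per inj eq] by (simp add: prod_eq_iff)
  qed
  have \<psi>: "continuous_on (\<phi> ` V) \<psi>" "inj_on \<psi> (\<phi> ` V)" "\<psi> ` (\<phi> ` V) = V" "\<And>y. y \<in> \<phi> ` V \<Longrightarrow> \<phi> (\<psi> y) = y"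
    using V(3) unfolding homeomorphism_def by (auto intro: inj_on_inverseI)
  have op: "open ((\<psi> \<circ> ?X) ` W)"
  proof (rule invariance_of_domain_gen[OF W])
    show "continuous_on W (\<psi> \<circ> ?X)"
      using \<psi>(1) XW by (intro continuous_on_compose cont') (rule continuous_on_subset)
    show "inj_on (\<psi> \<circ> ?X) W"
      using injX \<psi>(2) XW by (intro comp_inj_on) (auto intro: inj_on_subset)
  qed simp
  have eq: "?X ` W = \<phi> ` V \<inter> \<psi> -` ((\<psi> \<circ> ?X) ` W)"
  proof (intro set_eqI iffI)
    fix y assume "y \<in> \<phi> ` V \<inter> \<psi> -` ((\<psi> \<circ> ?X) ` W)"
    then obtain z where "y \<in> \<phi> ` V" "z \<in> W" "\<psi> y = \<psi> (?X z)" by auto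
    moreover from this have "?X z \<in> \<phi> ` V" using XW by blast
    ultimately have "y = ?X z" by (intro inj_onD[OF \<psi>(2)])
    then show "y \<in> ?X ` W" using \<open>z \<in> W\<close> by (rule image_eqI)
  qed (use XW in auto)
  have "openin (top_of_set (\<phi> ` V)) (?X ` W)"
    unfolding eq by (rule continuous_openin_preimage_gen[OF \<psi>(1) op])
  then have "openin (top_of_set \<Gamma>) (?X ` W)" using V(2) openin_trans by blast
  moreover have "X \<sigma> \<beta> \<in> ?X ` W"
    using q unfolding O'(2) W_def by (intro image_eqI[of _ _ "(\<sigma>, \<beta>)"]) auto
  moreover have "\<sigma> - 1 < s" if XW: "X s \<alpha> \<in> ?X ` W" for s \<alpha>
  proof -
    obtain z where "z \<in> W" "X s \<alpha> = ?X z" using XW by (rule imageE)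
    then show ?thesis using cylinder_injective(1)[OF per inj, of s \<alpha> "fst z" "snd z"] unfolding W_def by auto
  qed
  ultimately show ?thesis by (rule that)
qed

text \<open>An orbit leaving a small sphere around \<open>a\<close> has to cross the sphere, which is a compact set of
  regular points of the surface; orbits meet it only after a fixed time.\<close>

lemma cylinder_uniform_limit:
  fixes X :: "real \<Rightarrow> real \<Rightarrow> real^3"
  assumes surf: "C2_surface \<Gamma>" "compact \<Gamma>"
    and cont: "continuous_on UNIV (\<lambda>(s, \<alpha>). X s \<alpha>)"
    and per: "\<And>s \<alpha>. X s (\<alpha> + 1) = X s \<alpha>"
    and bij: "bij_betw (\<lambda>(s, \<alpha>). X s \<alpha>) (UNIV \<times> {0..<1}) (\<Gamma> - {a, b})"
    and lim: "\<And>\<alpha>. ((\<lambda>s. X s \<alpha>) \<longlongrightarrow> a) at_bot" and "a \<noteq> b" "\<delta> > 0"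
  obtains S where "\<And>s \<alpha>. s \<le> S \<Longrightarrow> dist (X s \<alpha>) a < \<delta>"
proof -
  \<comment> \<open>The sphere of radius \<open>r\<close> must miss \<open>b\<close> as well as
    \<open>a\<close>, so that every point of \<Gamma> on it is \<open>X \<sigma> \<beta>\<close> for
    some parameters.\<close>
  define r where "r = min \<delta> (dist a b) / 2"
  have r: "r > 0" "r < \<delta>" "r < dist b a"
    using \<open>a \<noteq> b\<close> \<open>\<delta> > 0\<close> unfolding r_def by (auto simp: min_def dist_commute)
  let ?K = "\<Gamma> \<inter> sphere a r"
  have K: "compact ?K" using surf(2) by (simp add: compact_Int_closed)
  have "\<exists>T S. open T \<and> q \<in> T \<and> (\<forall>s \<alpha>. X s \<alpha> \<in> T \<longrightarrow> S < s)" if q: "q \<in> ?K" for q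
  proof -
    have "q \<in> \<Gamma> - {a, b}" using q r by (auto simp: dist_commute)
    then have "q \<in> (\<lambda>(s, \<alpha>). X s \<alpha>) ` (UNIV \<times> {0..<1})" using bij by (simp only: bij_betw_def)
    then obtain \<sigma> \<beta> where \<sigma>: "q = X \<sigma> \<beta>" by auto
    obtain T where T: "openin (top_of_set \<Gamma>) T" "X \<sigma> \<beta> \<in> T" "\<And>s \<alpha>. X s \<alpha> \<in> T \<Longrightarrow> \<sigma> - 1 < s"
      using cylinder_local_return_bound[OF surf(1) cont per bij] by metis
    obtain T' where T': "open T'" "T = \<Gamma> \<inter> T'" using T(1) unfolding openin_open by blast
    have "\<forall>s \<alpha>. X s \<alpha> \<in> T' \<longrightarrow> \<sigma> - 1 < s"
      using cylinder_image_range[OF per bij] T(3) T'(2) by blast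
    then show ?thesis using T' T(2) \<sigma> by blast
  qed
  then obtain T S where TS: "\<And>q. q \<in> ?K \<Longrightarrow> open (T q) \<and> q \<in> T q \<and> (\<forall>s \<alpha>. X s \<alpha> \<in> T q \<longrightarrow> S q < (s::real))"
    by metis
  obtain C where C: "C \<subseteq> ?K" "finite C" "?K \<subseteq> (\<Union>q\<in>C. T q)"
    using compactE_image[OF K, of ?K T] TS by blast
  \<comment> \<open>Inserting 0 keeps the minimum defined when no point of \<Gamma> lies on the
    sphere and \<open>C\<close> is empty.\<close>
  define S0 where "S0 = Min (insert 0 (S ` C))"
  have S0: "S0 < s" if XK: "X s \<alpha> \<in> ?K" for s \<alpha>
  proof -
    obtain q where "q \<in> C" "X s \<alpha> \<in> T q" using C XK by blast
    then have "S q < s" using TS C(1) by blast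
    moreover have "S0 \<le> S q" unfolding S0_def using C(2) \<open>q \<in> C\<close> by (intro Min_le) auto
    ultimately show ?thesis by simp
  qed
  have "dist (X s \<alpha>) a < \<delta>" if s: "s \<le> S0" for s \<alpha>
  proof (rule ccontr)
    assume "\<not> ?thesis"
    then have gt: "r < dist (X s \<alpha>) a" using r by simp
    obtain s1 where "\<And>u. u \<le> s1 \<Longrightarrow> dist (X u \<alpha>) a < r"
      using tendstoD[OF lim[of \<alpha>] r(1)] unfolding eventually_at_bot_linorder by blast
    then have lt: "dist (X (min s1 s) \<alpha>) a < r" by simp
    have "continuous_on UNIV (\<lambda>u. X u \<alpha>)"
      using continuous_on_compose2[OF cont, of UNIV "\<lambda>u. (u, \<alpha>)"] by (simp add: continuous_intros)
    then have "continuous_on {min s1 s..s} (\<lambda>u. dist (X u \<alpha>) a)"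
      by (intro continuous_intros) (rule continuous_on_subset, auto)
    then obtain u where u: "u \<le> s" "dist (X u \<alpha>) a = r"
      using IVT'[of "\<lambda>u. dist (X u \<alpha>) a" "min s1 s" r s, OF less_imp_le[OF lt] less_imp_le[OF gt]]
      by (metis min.cobounded2)
    then have "X u \<alpha> \<in> ?K" using cylinder_image_range[OF per bij, of u \<alpha>] by (auto simp: dist_commute)
    then show False using S0[of u \<alpha>] u s by simp
  qed
  then show ?thesis by (rule that)
qed

text \<open>With \<open>h = S - \<kappa> U\<close> one gets \<open>h' \<le> k h\<close> along \<open>d\<close>; as \<open>k < 0\<close>, a positive value of \<open>h\<close> would
  grow exponentially backward in time, against the boundedness of \<open>d\<close>.\<close>

lemma cone_backward_invariant:
  fixes d d' :: "real \<Rightarrow> 'a::real_normed_vector" and A :: "'a \<Rightarrow>\<^sub>L 'a" and S U :: "'a \<Rightarrow> 'a \<Rightarrow> real"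
  assumes bil: "bounded_bilinear S" "bounded_bilinear U"
    and sym: "\<And>x y. S x y = S y x" "\<And>x y. U x y = U y x"
    and SA: "\<And>x. S x (A x) = k * S x x" and UA: "\<And>x. \<mu> * U x x \<le> U x (A x)"
    and pos: "\<And>x. 0 \<le> S x x" "\<And>x. 0 \<le> U x x" "\<And>x. c * (norm x)\<^sup>2 \<le> S x x + U x x"
    and bnd: "\<And>x y. \<bar>S x y\<bar> \<le> norm x * norm y * KS" "\<And>x y. \<bar>U x y\<bar> \<le> norm x * norm y * KU"
    and k: "k < 0" and \<mu>: "\<mu> > 0" and \<kappa>: "\<kappa> > 0" and c: "c > 0"
    and \<eta>: "2 * \<eta> * (KS + \<kappa> * KU) \<le> c * min (- k) (\<kappa> * \<mu>)" "0 \<le> KS" "0 \<le> KU"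
    and d: "\<And>s. s \<le> s0 \<Longrightarrow> (d has_vector_derivative d' s) (at s)"
    and d': "\<And>s. s \<le> s0 \<Longrightarrow> norm (d' s - A (d s)) \<le> \<eta> * norm (d s)"
    and R: "\<And>s. s \<le> s0 \<Longrightarrow> norm (d s) \<le> R"
  shows "S (d s0) (d s0) \<le> \<kappa> * U (d s0) (d s0)"
proof (rule ccontr)
  define h where "h s = S (d s) (d s) - \<kappa> * U (d s) (d s)" for s
  assume "\<not> ?thesis"
  then have h0: "h s0 > 0" unfolding h_def by simp
  define h' where "h' s = 2 * S (d s) (d' s) - \<kappa> * (2 * U (d s) (d' s))" for s
  have dh: "(h has_real_derivative h' s) (at s)" if s: "s \<le> s0" for s
  proof -
    have "((\<lambda>s. S (d s) (d s)) has_vector_derivative S (d s) (d' s) + S (d' s) (d s)) (at s)"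
      "((\<lambda>s. U (d s) (d s)) has_vector_derivative U (d s) (d' s) + U (d' s) (d s)) (at s)"
      by (rule bounded_bilinear.has_vector_derivative[OF bil(1) d[OF s] d[OF s]]
          bounded_bilinear.has_vector_derivative[OF bil(2) d[OF s] d[OF s]])+
    then have "((\<lambda>s. S (d s) (d s)) has_real_derivative 2 * S (d s) (d' s)) (at s)"
      "((\<lambda>s. U (d s) (d s)) has_real_derivative 2 * U (d s) (d' s)) (at s)"
      by (simp_all add: has_real_derivative_iff_has_vector_derivative sym(1)[of "d' s"] sym(2)[of "d' s"])
    then show ?thesis
      unfolding h_def[abs_def] h'_def by (intro DERIV_diff DERIV_cmult)
  qed
  have h'_le: "h' s \<le> k * h s" if s: "s \<le> s0" for s
  proof -
    let ?x = "d s" let ?e = "d' s - A (d s)" let ?m = "min (- k) (\<kappa> * \<mu>)"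
    have split: "d' s = A ?x + ?e" by simp
    have "S ?x (d' s) = k * S ?x ?x + S ?x ?e"
      by (subst split) (simp only: bounded_bilinear.add_right[OF bil(1)] SA)
    moreover have "U ?x (d' s) = U ?x (A ?x) + U ?x ?e"
      by (subst split) (simp only: bounded_bilinear.add_right[OF bil(2)])
    moreover have "\<bar>S ?x ?e\<bar> \<le> \<eta> * KS * (norm ?x)\<^sup>2"
    proof (rule order.trans[OF bnd(1)])
      have "norm ?x * norm ?e * KS \<le> norm ?x * (\<eta> * norm ?x) * KS"
        using d'[OF s] \<eta>(2) by (intro mult_right_mono mult_left_mono) auto
      then show "norm ?x * norm ?e * KS \<le> \<eta> * KS * (norm ?x)\<^sup>2"
        by (simp add: power2_eq_square algebra_simps)
    qed
    moreover have "\<bar>U ?x ?e\<bar> \<le> \<eta> * KU * (norm ?x)\<^sup>2"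
    proof (rule order.trans[OF bnd(2)])
      have "norm ?x * norm ?e * KU \<le> norm ?x * (\<eta> * norm ?x) * KU"
        using d'[OF s] \<eta>(3) by (intro mult_right_mono mult_left_mono) auto
      then show "norm ?x * norm ?e * KU \<le> \<eta> * KU * (norm ?x)\<^sup>2"
        by (simp add: power2_eq_square algebra_simps)
    qed
    moreover have "\<kappa> * (\<mu> * U ?x ?x) \<le> \<kappa> * U ?x (A ?x)"
      using UA[of ?x] \<kappa> by (intro mult_left_mono) auto
    moreover have "- (\<kappa> * U ?x ?e) \<le> \<kappa> * (\<eta> * KU * (norm ?x)\<^sup>2)"
    proof -
      have "\<kappa> * (- U ?x ?e) \<le> \<kappa> * (\<eta> * KU * (norm ?x)\<^sup>2)"
        using calculation(4) \<kappa> by (intro mult_left_mono) auto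
      then show ?thesis by simp
    qed
    ultimately have "h' s \<le> 2 * k * S ?x ?x - 2 * (\<kappa> * (\<mu> * U ?x ?x)) + 2 * \<eta> * (KS + \<kappa> * KU) * (norm ?x)\<^sup>2"
      unfolding h'_def by (simp add: algebra_simps)
    \<comment> \<open>The bound on \<open>\<eta>\<close> lets the nonlinear error consume at most
      half of the linear terms \<open>2 * k * S\<close> and \<open>2 * \<kappa> * \<mu> * U\<close>;
      the other half gives \<open>h' \<le> k * h\<close>.\<close>
    also have "2 * \<eta> * (KS + \<kappa> * KU) * (norm ?x)\<^sup>2 \<le> c * ?m * (norm ?x)\<^sup>2"
      by (intro mult_right_mono \<eta>(1)) simp
    also have "c * ?m * (norm ?x)\<^sup>2 = ?m * (c * (norm ?x)\<^sup>2)" by simp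
    also have "\<dots> \<le> ?m * (S ?x ?x + U ?x ?x)"
      using k \<kappa> \<mu> by (intro mult_left_mono pos) auto
    also have "\<dots> \<le> - k * S ?x ?x + \<kappa> * \<mu> * U ?x ?x"
      unfolding distrib_left by (intro add_mono mult_right_mono pos) auto
    finally have "h' s \<le> k * S ?x ?x - \<kappa> * \<mu> * U ?x ?x" by (simp add: algebra_simps)
    also have "\<dots> \<le> k * S ?x ?x" using \<kappa> \<mu> pos(2)[of ?x] by simp
    also have "\<dots> \<le> k * h s"
      using k \<kappa> pos(2)[of ?x] unfolding h_def by (intro mult_left_mono_neg) auto
    finally show ?thesis .
  qed
  have mono: "h s0 * exp (- k * s0) \<le> h s * exp (- k * s)" if "s \<le> s0" for s
  proof (rule DERIV_nonpos_imp_nonincreasing[OF that])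
    fix x assume "s \<le> x" "x \<le> s0"
    have "((\<lambda>s. h s * exp (- k * s)) has_real_derivative h' x * exp (- k * x) + h x * (exp (- k * x) * (- k))) (at x)"
      using dh[OF \<open>x \<le> s0\<close>] by (auto intro!: derivative_eq_intros)
    moreover have "h' x * exp (- k * x) + h x * (exp (- k * x) * (- k)) = (h' x - k * h x) * exp (- k * x)"
      by (simp add: algebra_simps)
    moreover have "\<dots> \<le> 0" using h'_le[OF \<open>x \<le> s0\<close>] by (intro mult_nonpos_nonneg) auto
    ultimately show "\<exists>y. ((\<lambda>s. h s * exp (- k * s)) has_real_derivative y) (at x) \<and> y \<le> 0" by auto
  qed
  \<comment> \<open>\<open>t * h s0\<close> is the a priori bound \<open>KS * R\<^sup>2\<close> of
    \<open>h\<close>. Back at time \<open>s\<close> the growth factor is at least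
    \<open>exp t\<close>, and \<open>exp t \<ge> 1 + t\<close> exceeds \<open>t\<close>.\<close>
  define t where "t = KS * R\<^sup>2 / h s0"
  define s where "s = s0 + t / k"
  have t: "t \<ge> 0" unfolding t_def using \<eta>(2) h0 by simp
  have s: "s \<le> s0" unfolding s_def using t k by (simp add: divide_nonneg_neg)
  have "h s \<le> S (d s) (d s)" unfolding h_def using \<kappa> pos(2)[of "d s"] by simp
  also have "\<dots> \<le> norm (d s) * norm (d s) * KS" using bnd(1)[of "d s" "d s"] by linarith
  also have "\<dots> \<le> R * R * KS"
    using R[OF s] \<eta>(2) by (intro mult_right_mono mult_mono) (auto intro: order.trans[OF norm_ge_zero])
  finally have hs: "h s \<le> t * h s0" unfolding t_def using h0 by (simp add: power2_eq_square mult.commute)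
  have "h s0 * (1 + t) \<le> h s0 * exp t" using h0 exp_ge_add_one_self[of t] by simp
  also have "exp t = exp (- k * s0) * exp (k * s)"
    unfolding s_def exp_add[symmetric] using k by (simp add: field_simps)
  also have "h s0 * (exp (- k * s0) * exp (k * s)) \<le> h s * exp (- k * s) * exp (k * s)"
    using mult_right_mono[OF mono[OF s], of "exp (k * s)"] by (simp add: mult.assoc)
  also have "\<dots> = h s" by (simp add: mult.assoc exp_add[symmetric])
  finally show False using hs h0 by (simp add: algebra_simps)
qed

lemma has_vector_derivative_quotient_tendsto:
  assumes "(\<gamma> has_vector_derivative D) (at 0)"
  shows "((\<lambda>\<theta>. (\<gamma> \<theta> - \<gamma> 0) /\<^sub>R \<theta>) \<longlongrightarrow> D) (at 0)"
proof -
  have "((\<lambda>\<theta>. norm (\<gamma> \<theta> - \<gamma> 0 - \<theta> *\<^sub>R D) / norm \<theta>) \<longlongrightarrow> 0) (at 0)"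
    using assms unfolding has_vector_derivative_def has_derivative_at by simp
  moreover have "\<forall>\<^sub>F \<theta> in at 0. norm (\<gamma> \<theta> - \<gamma> 0 - \<theta> *\<^sub>R D) / norm \<theta> = norm ((\<gamma> \<theta> - \<gamma> 0) /\<^sub>R \<theta> - D)"
    unfolding eventually_at_filter
  proof (intro always_eventually allI impI)
    fix \<theta> :: real assume "\<theta> \<noteq> 0"
    then have "(\<gamma> \<theta> - \<gamma> 0) /\<^sub>R \<theta> - D = (\<gamma> \<theta> - \<gamma> 0 - \<theta> *\<^sub>R D) /\<^sub>R \<theta>"
      by (simp add: scaleR_diff_right)
    then show "norm (\<gamma> \<theta> - \<gamma> 0 - \<theta> *\<^sub>R D) / norm \<theta> = norm ((\<gamma> \<theta> - \<gamma> 0) /\<^sub>R \<theta> - D)"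
      by (simp add: divide_inverse mult.commute)
  qed
  ultimately have "((\<lambda>\<theta>. norm ((\<gamma> \<theta> - \<gamma> 0) /\<^sub>R \<theta> - D)) \<longlongrightarrow> 0) (at 0)"
    by (rule Lim_transform_eventually)
  then show ?thesis
    by (rule LIM_zero_cancel[OF tendsto_norm_zero_cancel])
qed

text \<open>No bound on \<open>Xa\<close> near \<open>a\<close> is available beforehand. The cone estimate is therefore applied to
  differences of orbits, which are bounded, and passes to tangent vectors in the limit.\<close>

lemma tangent_plane_narrow_cone:
  fixes f :: "'a::euclidean_space \<Rightarrow> 'a" and f' :: "'a \<Rightarrow> 'a \<Rightarrow>\<^sub>L 'a" and X Xa :: "real \<Rightarrow> real \<Rightarrow> 'a"
    and S U :: "'a \<Rightarrow> 'a \<Rightarrow> real"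
  assumes \<Omega>: "open \<Omega>" "a \<in> \<Omega>"
    and f': "\<And>x. x \<in> \<Omega> \<Longrightarrow> (f has_derivative f' x) (at x)" and contf': "continuous_on \<Omega> f'"
    and flow: "\<And>s \<alpha>. ((\<lambda>s. X s \<alpha>) has_vector_derivative f (X s \<alpha>)) (at s)"
    and unif: "\<And>\<delta>. \<delta> > 0 \<Longrightarrow> \<exists>T. \<forall>s\<le>T. \<forall>\<alpha>. dist (X s \<alpha>) a < \<delta>"
    and X': "\<And>s \<alpha>. ((\<lambda>(s, \<alpha>). X s \<alpha>) has_derivative (\<lambda>(u, v). u *\<^sub>R f (X s \<alpha>) + v *\<^sub>R Xa s \<alpha>)) (at (s, \<alpha>))"
    and bil: "bounded_bilinear S" "bounded_bilinear U"
    and sym: "\<And>x y. S x y = S y x" "\<And>x y. U x y = U y x"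
    and SA: "\<And>x. S x (f' a x) = k * S x x" and UA: "\<And>x. \<mu> * U x x \<le> U x (f' a x)"
    and pos: "\<And>x. 0 \<le> S x x" "\<And>x. 0 \<le> U x x" "\<And>x. c * (norm x)\<^sup>2 \<le> S x x + U x x"
    and k: "k < 0" and \<mu>: "\<mu> > 0" and c: "c > 0" and \<kappa>: "\<kappa> > 0"
  obtains T where "\<And>s \<alpha> u v. s < T \<Longrightarrow>
    S (u *\<^sub>R f (X s \<alpha>) + v *\<^sub>R Xa s \<alpha>) (u *\<^sub>R f (X s \<alpha>) + v *\<^sub>R Xa s \<alpha>)
     \<le> \<kappa> * U (u *\<^sub>R f (X s \<alpha>) + v *\<^sub>R Xa s \<alpha>) (u *\<^sub>R f (X s \<alpha>) + v *\<^sub>R Xa s \<alpha>)"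
proof -
  obtain KS where KS: "KS > 0" "\<And>x y. \<bar>S x y\<bar> \<le> norm x * norm y * KS"
    using bounded_bilinear.pos_bounded[OF bil(1)] by auto
  obtain KU where KU: "KU > 0" "\<And>x y. \<bar>U x y\<bar> \<le> norm x * norm y * KU"
    using bounded_bilinear.pos_bounded[OF bil(2)] by auto
  \<comment> \<open>The largest relative nonlinearity that the cone estimate allows; continuity of
    \<open>f'\<close> provides it on a small ball around \<open>a\<close>.\<close>
  define \<eta> where "\<eta> = c * min (- k) (\<kappa> * \<mu>) / (2 * (KS + \<kappa> * KU))"
  have KK: "KS + \<kappa> * KU > 0" using KS(1) KU(1) \<kappa> by (intro add_pos_pos mult_pos_pos)
  have "2 * (m / (2 * r)) * r = m" if "r > 0" for m r :: real using that by simp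
  from this[OF KK] have \<eta>: "\<eta> > 0" "2 * \<eta> * (KS + \<kappa> * KU) \<le> c * min (- k) (\<kappa> * \<mu>)"
    unfolding \<eta>_def using KK c k \<kappa> \<mu> by (simp_all del: distrib_left_numeral)
  obtain \<delta>1 where \<delta>1: "\<delta>1 > 0" "ball a \<delta>1 \<subseteq> \<Omega>" using \<Omega> open_contains_ball by blast
  obtain \<delta>2 where \<delta>2: "\<delta>2 > 0" "\<And>x. x \<in> \<Omega> \<Longrightarrow> dist x a < \<delta>2 \<Longrightarrow> dist (f' x) (f' a) < \<eta>"
    using contf' \<Omega>(2) \<eta>(1) unfolding continuous_on_iff by metis
  define \<delta> where "\<delta> = min \<delta>1 \<delta>2"
  have \<delta>: "\<delta> > 0" "ball a \<delta> \<subseteq> \<Omega>" "\<And>x. x \<in> ball a \<delta> \<Longrightarrow> norm (f' x - f' a) \<le> \<eta>"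
    unfolding \<delta>_def using \<delta>1 \<delta>2 by (auto simp: dist_commute subset_iff dist_norm intro: less_imp_le)
  \<comment> \<open>The derivative is frozen at \<open>a\<close> while both points vary: a
    difference of two orbits solves the linearization at \<open>a\<close> up to the relative error
    \<open>\<eta>\<close>.\<close>
  have lin: "norm (f y - f x - f' a (y - x)) \<le> \<eta> * norm (y - x)" if xy: "x \<in> ball a \<delta>" "y \<in> ball a \<delta>" for x y
  proof -
    have "norm (f y - f x - f' a (y - x)) \<le> norm (y - x) * \<eta>"
    proof (rule differentiable_bound_linearization[of x y "ball a \<delta>" f "\<lambda>z. blinfun_apply (f' z)" a])
      show "x + t *\<^sub>R (y - x) \<in> ball a \<delta>" if "t \<in> {0..1}" for t
        using convexD_alt[OF convex_ball xy, of t] that by (simp add: algebra_simps)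
      show "(f has_derivative f' z) (at z within ball a \<delta>)" if "z \<in> ball a \<delta>" for z
        using f' that \<delta>(2) has_derivative_at_withinI by blast
      show "onorm (blinfun_apply (f' z) - blinfun_apply (f' a)) \<le> \<eta>" if "z \<in> ball a \<delta>" for z
        using \<delta>(3)[OF that] by (simp add: norm_blinfun.rep_eq minus_blinfun.rep_eq fun_diff_def)
    qed (use \<delta>(1) in auto)
    then show ?thesis by (simp add: mult.commute)
  qed
  obtain T where T: "\<And>s \<alpha>. s \<le> T \<Longrightarrow> X s \<alpha> \<in> ball a \<delta>"
    using unif[OF \<delta>(1)] by (auto simp: dist_commute)
  have "S D D \<le> \<kappa> * U D D" if s: "s < T" and D: "D = u *\<^sub>R f (X s \<alpha>) + v *\<^sub>R Xa s \<alpha>" for s \<alpha> u v D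
  proof -
    \<comment> \<open>The image of a line through \<open>(s, \<alpha>)\<close> in the parameter
      plane. \<open>\<gamma> \<theta> - \<gamma> 0\<close> is the value at time \<open>s\<close> of
      a difference of two orbits, one of them shifted by \<open>\<theta> * u\<close> in time and by
      \<open>\<theta> * v\<close> in label.\<close>
    define \<gamma> where "\<gamma> \<theta> = X (s + \<theta> * u) (\<alpha> + \<theta> * v)" for \<theta>
    have "((\<lambda>\<theta>. (\<lambda>(s, \<alpha>). X s \<alpha>) (s + \<theta> * u, \<alpha> + \<theta> * v)) has_derivative
      (\<lambda>\<theta>. (\<lambda>(u, v). u *\<^sub>R f (X s \<alpha>) + v *\<^sub>R Xa s \<alpha>) (\<theta> * u, \<theta> * v))) (at 0)"
      by (rule has_derivative_compose[where g="\<lambda>(s, \<alpha>). X s \<alpha>"])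
        (use X'[of s \<alpha>] in \<open>auto intro!: derivative_eq_intros\<close>)
    then have "(\<gamma> has_vector_derivative D) (at 0)"
      unfolding has_vector_derivative_def \<gamma>_def[abs_def] D by (simp add: scaleR_add_right)
    then have quot: "((\<lambda>\<theta>. (\<gamma> \<theta> - \<gamma> 0) /\<^sub>R \<theta>) \<longlongrightarrow> D) (at 0)"
      by (rule has_vector_derivative_quotient_tendsto)
    have small: "S (\<gamma> \<theta> - \<gamma> 0) (\<gamma> \<theta> - \<gamma> 0) \<le> \<kappa> * U (\<gamma> \<theta> - \<gamma> 0) (\<gamma> \<theta> - \<gamma> 0)"
      if \<theta>: "s + \<theta> * u < T" for \<theta>
    proof -
      let ?d = "\<lambda>\<sigma>. X (\<sigma> + \<theta> * u) (\<alpha> + \<theta> * v) - X \<sigma> \<alpha>"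
      let ?d' = "\<lambda>\<sigma>. f (X (\<sigma> + \<theta> * u) (\<alpha> + \<theta> * v)) - f (X \<sigma> \<alpha>)"
      have "S (?d s) (?d s) \<le> \<kappa> * U (?d s) (?d s)"
      proof (rule cone_backward_invariant[where d="?d" and d'="?d'" and R="2 * \<delta>", OF bil sym SA UA pos KS(2) KU(2) k \<mu> \<kappa> c \<eta>(2)])
        fix \<sigma> assume \<sigma>: "\<sigma> \<le> s"
        have in_ball: "X (\<sigma> + \<theta> * u) (\<alpha> + \<theta> * v) \<in> ball a \<delta>" "X \<sigma> \<alpha> \<in> ball a \<delta>"
          using T \<sigma> s \<theta> by auto
        have "((\<lambda>r. X r (\<alpha> + \<theta> * v)) \<circ> (\<lambda>\<sigma>. \<sigma> + \<theta> * u) has_vector_derivative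
            1 *\<^sub>R f (X (\<sigma> + \<theta> * u) (\<alpha> + \<theta> * v))) (at \<sigma>)"
          by (intro vector_diff_chain_at flow) (auto intro!: derivative_eq_intros)
        then show "(?d has_vector_derivative ?d' \<sigma>) (at \<sigma>)"
          by (intro has_vector_derivative_diff flow) (simp add: o_def)
        show "norm (?d' \<sigma> - f' a (?d \<sigma>)) \<le> \<eta> * norm (?d \<sigma>)"
          by (rule lin[OF in_ball(2,1)])
        show "norm (?d \<sigma>) \<le> 2 * \<delta>"
          using in_ball dist_triangle_less_add[of _ a \<delta> _ \<delta>] by (auto simp: dist_norm norm_minus_commute intro!: less_imp_le)
      qed (use KS KU in auto)
      then show ?thesis by (simp add: \<gamma>_def)
    qed
    have "((\<lambda>\<theta>. s + \<theta> * u) \<longlongrightarrow> s + 0 * u) (at 0)" by (intro tendsto_intros)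
    then have ev: "\<forall>\<^sub>F \<theta> in at 0. s + \<theta> * u < T" using s by (intro order_tendstoD) auto
    have "\<forall>\<^sub>F \<theta> in at 0. S ((\<gamma> \<theta> - \<gamma> 0) /\<^sub>R \<theta>) ((\<gamma> \<theta> - \<gamma> 0) /\<^sub>R \<theta>)
        \<le> \<kappa> * U ((\<gamma> \<theta> - \<gamma> 0) /\<^sub>R \<theta>) ((\<gamma> \<theta> - \<gamma> 0) /\<^sub>R \<theta>)"
      using ev
    proof eventually_elim
      case (elim \<theta>)
      \<comment> \<open>Both sides are homogeneous of degree 2, so the inequality passes to the
        difference quotient, and being closed it survives the limit.\<close>
      show ?case
        using mult_left_mono[OF small[OF elim], of "inverse \<theta> * inverse \<theta>"]
        by (simp add: bounded_bilinear.scaleR_left[OF bil(1)] bounded_bilinear.scaleR_right[OF bil(1)]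
          bounded_bilinear.scaleR_left[OF bil(2)] bounded_bilinear.scaleR_right[OF bil(2)] mult.assoc mult.left_commute)
    qed
    then show ?thesis
      by (intro tendsto_le[OF _ tendsto_mult[OF tendsto_const bounded_bilinear.tendsto[OF bil(2) quot quot]]
            bounded_bilinear.tendsto[OF bil(1) quot quot]]) auto
  qed
  then show ?thesis using that by blast
qed

subsection \<open>The adjoint variational equation\<close>

text \<open>The infinitesimal form of (A u) x (A v) = det A * A^-T (u x v): differentiation at A = I
  in direction \<open>M\<close> turns the determinant into the trace and the inverse transpose into
  \<open>- transpose M\<close>.\<close>

lemma cross3_linear_trace:
  fixes M :: "real^3^3"
  shows "cross3 (M *v u) v + cross3 u (M *v v) = trace M *\<^sub>R cross3 u v - transpose M *v cross3 u v"
  by (simp add: cross3_simps matrix_vector_mult_def trace_def transpose_def forall_3)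

text \<open>The tangential part of \<open>l\<close> in terms of \<open>u\<close> and
  \<open>v\<close>: the coefficients solve the two Gram equations, whose determinant is
  \<open>N \<bullet> N\<close> by Lagrange's identity. It places that part in the tangent plane,
  where the cone condition applies.\<close>

lemma cross3_projection:
  fixes u v l :: "real^3"
  defines "N \<equiv> cross3 u v"
  shows "(N \<bullet> N) *\<^sub>R l - (l \<bullet> N) *\<^sub>R N =
    ((l \<bullet> u) * (v \<bullet> v) - (l \<bullet> v) * (u \<bullet> v)) *\<^sub>R u + ((l \<bullet> v) * (u \<bullet> u) - (l \<bullet> u) * (u \<bullet> v)) *\<^sub>R v"
  unfolding N_def by (simp add: cross3_simps forall_3)

text \<open>The tangent plane approaches the unstable eigenspace, which is orthogonal to the left eigenvector
  of the negative eigenvalue \<open>k\<close>. Hence the normal \<open>V\<close> aligns with that eigenvector and decays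
  backward in time.\<close>

lemma adjoint_backward_decay:
  fixes f :: "real^3 \<Rightarrow> real^3" and f' :: "real^3 \<Rightarrow> ((real^3) \<Rightarrow>\<^sub>L (real^3))" and X Xa :: "real \<Rightarrow> real \<Rightarrow> real^3"
    and A :: "real^3^3" and V V' :: "real \<Rightarrow> real^3" and e :: "real \<Rightarrow> real"
  assumes \<Omega>: "open \<Omega>" "a \<in> \<Omega>"
    and f': "\<And>x. x \<in> \<Omega> \<Longrightarrow> (f has_derivative f' x) (at x)" and contf': "continuous_on \<Omega> f'"
    and A: "\<And>v. f' a v = A *v v" "one_neg_two_pos_spectrum A"
    and flow: "\<And>s \<alpha>. ((\<lambda>s. X s \<alpha>) has_vector_derivative f (X s \<alpha>)) (at s)"
    and unif: "\<And>\<delta>. \<delta> > 0 \<Longrightarrow> \<exists>T. \<forall>s\<le>T. \<forall>\<alpha>. dist (X s \<alpha>) a < \<delta>"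
    and X': "\<And>s \<alpha>. ((\<lambda>(s, \<alpha>). X s \<alpha>) has_derivative (\<lambda>(u, v). u *\<^sub>R f (X s \<alpha>) + v *\<^sub>R Xa s \<alpha>)) (at (s, \<alpha>))"
    and V: "\<And>s. (V has_vector_derivative V' s) (at s)" "\<And>s w. V' s \<bullet> w = - (V s \<bullet> f' (X s \<alpha>) w)"
    and V_eq: "\<And>s. V s = e s *\<^sub>R cross3 (f (X s \<alpha>)) (Xa s \<alpha>)" and V_nz: "\<And>s. V s \<noteq> 0"
  obtains c T C where "c > 0" "\<forall>s\<le>T. norm (V s) \<le> C * exp (c * s)"
proof -
  obtain k \<mu> c l S U where k: "k < 0" and pos: "\<mu> > 0" "c > 0" and l0: "l \<noteq> 0"
    and l: "\<And>d. l \<bullet> (A *v d) = k * (l \<bullet> d)"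
    and bil: "bounded_bilinear S" "bounded_bilinear U"
    and sym: "\<And>x y. S x y = S y x" "\<And>x y. U x y = U y x"
    and SU: "\<And>d. S d (A *v d) = k * S d d" "\<And>d. \<mu> * U d d \<le> U d (A *v d)"
      "\<And>d. 0 \<le> U d d" "\<And>d. (l \<bullet> d)\<^sup>2 \<le> S d d" "\<And>d. c * (norm d)\<^sup>2 \<le> S d d + U d d"
    by (rule saddle_forms[OF A(2)]) blast
  have S_pos: "0 \<le> S d d" for d using SU(4)[of d] zero_le_power2 order.trans by blast
  obtain KU where KU: "KU > 0" "\<And>x y. \<bar>U x y\<bar> \<le> norm x * norm y * KU"
    using bounded_bilinear.pos_bounded[OF bil(2)] by auto
  define n where "n = norm (f' a)"
  have n: "n \<ge> 0" unfolding n_def by simp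
  \<comment> \<open>\<open>\<rho>\<close> will bound the tangential part \<open>u\<close> of
    \<open>l\<close>. The first entry leaves the normal part \<open>y\<close> at least half as long
    as \<open>l\<close>; the second keeps the mixed term \<open>- (u \<bullet> f' a y)\<close> below
    \<open>- k / 4\<close> times the squared length of \<open>y\<close>. \<open>n + 1\<close> avoids
    division by zero.\<close>
  define \<rho> where "\<rho> = min (norm l / 2) (- k * norm l / (8 * (n + 1)))"
  have \<rho>: "\<rho> > 0" "\<rho> \<le> norm l / 2" "\<rho> * n \<le> - k / 8 * norm l"
  proof -
    have "- k * norm l / (8 * (n + 1)) > 0" using l0 k n by (intro divide_pos_pos mult_pos_pos) auto
    then show "\<rho> > 0" unfolding \<rho>_def using l0 by simp
    show "\<rho> \<le> norm l / 2" unfolding \<rho>_def by (rule min.cobounded1)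
    have "\<rho> * n \<le> \<rho> * (n + 1)" using \<open>\<rho> > 0\<close> by simp
    also have "\<dots> \<le> - k * norm l / (8 * (n + 1)) * (n + 1)"
      unfolding \<rho>_def using n by (intro mult_right_mono) auto
    also have "\<dots> = - k / 8 * norm l" using n by (simp add: field_simps)
    finally show "\<rho> * n \<le> - k / 8 * norm l" .
  qed
  \<comment> \<open>Chosen so that the cone inequality for \<open>u\<close>, with
    \<open>U u u \<le> KU * (norm u)\<^sup>2\<close>, becomes
    \<open>\<bar>l \<bullet> u\<bar> \<le> \<rho> * norm u\<close>.\<close>
  define \<kappa> where "\<kappa> = \<rho>\<^sup>2 / KU"
  have \<kappa>: "\<kappa> > 0" unfolding \<kappa>_def using \<rho>(1) KU(1) by simp
  obtain T1 where T1: "\<And>s \<alpha> u v. s < T1 \<Longrightarrow>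
    S (u *\<^sub>R f (X s \<alpha>) + v *\<^sub>R Xa s \<alpha>) (u *\<^sub>R f (X s \<alpha>) + v *\<^sub>R Xa s \<alpha>)
     \<le> \<kappa> * U (u *\<^sub>R f (X s \<alpha>) + v *\<^sub>R Xa s \<alpha>) (u *\<^sub>R f (X s \<alpha>) + v *\<^sub>R Xa s \<alpha>)"
    using tangent_plane_narrow_cone[OF \<Omega> f' contf' flow unif X' bil sym, of k \<mu> c \<kappa>]
      SU S_pos k pos \<kappa> unfolding A(1) by blast
  obtain \<delta>1 where \<delta>1: "\<delta>1 > 0" "ball a \<delta>1 \<subseteq> \<Omega>" using \<Omega> open_contains_ball by blast
  \<comment> \<open>Rate budget: the mixed term costs \<open>- k / 4\<close>, the variation of
    \<open>f'\<close> along the orbit another \<open>- k / 4\<close>, so half of the rate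
    \<open>k\<close> remains.\<close>
  obtain \<delta>2 where \<delta>2: "\<delta>2 > 0" "\<And>x. x \<in> \<Omega> \<Longrightarrow> dist x a < \<delta>2 \<Longrightarrow> dist (f' x) (f' a) < - k / 4"
    using contf' \<Omega>(2) k unfolding continuous_on_iff by (metis divide_pos_pos neg_0_less_iff_less zero_less_numeral)
  obtain T2 where T2: "\<And>s \<alpha>. s \<le> T2 \<Longrightarrow> dist (X s \<alpha>) a < min \<delta>1 \<delta>2"
    using unif[of "min \<delta>1 \<delta>2"] \<delta>1(1) \<delta>2(1) unfolding min_less_iff_conj by blast
  define T where "T = min (T1 - 1) T2"
  have f'_near: "norm (f' (X s \<alpha>) - f' a) \<le> - k / 4" if "s \<le> T" for s
  proof -
    have "dist (X s \<alpha>) a < min \<delta>1 \<delta>2" using T2 that unfolding T_def by simp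
    then have "X s \<alpha> \<in> \<Omega>" "dist (X s \<alpha>) a < \<delta>2" using \<delta>1(2) by (auto simp: dist_commute)
    from \<delta>2(2)[OF this] show ?thesis by (simp add: dist_norm)
  qed
  have VAV: "V s \<bullet> f' (X s \<alpha>) (V s) \<le> k / 2 * (norm (V s))\<^sup>2" if s: "s \<le> T" for s
  proof -
    define N where "N = cross3 (f (X s \<alpha>)) (Xa s \<alpha>)"
    have N0: "N \<noteq> 0" using V_nz[of s] V_eq[of s] unfolding N_def by auto
    \<comment> \<open>Orthogonal splitting \<open>l = u + y\<close> into a tangential and a normal
      part; hence \<open>l \<bullet> u\<close> and \<open>l \<bullet> y\<close> are the squared
      lengths of \<open>u\<close> and \<open>y\<close>.\<close>
    define q where "q = (l \<bullet> N) / (N \<bullet> N)"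
    define y where "y = q *\<^sub>R N"
    define u where "u = l - y"
    have uN: "u \<bullet> N = 0" unfolding u_def y_def q_def using N0 by (simp add: inner_diff_left)
    have ly: "l = u + y" unfolding u_def by simp
    have uy: "u \<bullet> y = 0" "y \<bullet> u = 0" using uN unfolding y_def by (simp_all add: inner_commute)
    have "(N \<bullet> N) *\<^sub>R u = (N \<bullet> N) *\<^sub>R l - (l \<bullet> N) *\<^sub>R N"
      unfolding u_def y_def q_def using N0 by (simp add: scaleR_diff_right)
    then obtain x1 x2 where "(N \<bullet> N) *\<^sub>R u = x1 *\<^sub>R f (X s \<alpha>) + x2 *\<^sub>R Xa s \<alpha>"
      using cross3_projection[of "f (X s \<alpha>)" "Xa s \<alpha>" l] unfolding N_def by metis
    then have "u = inverse (N \<bullet> N) *\<^sub>R (x1 *\<^sub>R f (X s \<alpha>) + x2 *\<^sub>R Xa s \<alpha>)"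
      using N0 by (metis inner_eq_zero_iff scaleR_one scaleR_scaleR left_inverse)
    then have u_span: "u = (x1 / (N \<bullet> N)) *\<^sub>R f (X s \<alpha>) + (x2 / (N \<bullet> N)) *\<^sub>R Xa s \<alpha>"
      by (simp add: scaleR_add_right divide_inverse mult.commute)
    have "(l \<bullet> u)\<^sup>2 \<le> S u u" by (rule SU(4))
    also have "\<dots> \<le> \<kappa> * U u u"
      unfolding u_span using s by (intro T1) (auto simp: T_def)
    also have "\<dots> \<le> \<kappa> * (norm u * norm u * KU)"
      using KU(2)[of u u] \<kappa> by (intro mult_left_mono) auto
    also have "\<dots> = (\<rho> * norm u)\<^sup>2"
      unfolding \<kappa>_def using KU(1) by (simp add: power2_eq_square)
    finally have "\<bar>l \<bullet> u\<bar> \<le> \<rho> * norm u"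
      using \<rho>(1) by (simp add: abs_le_square_iff[symmetric] abs_mult)
    moreover have "l \<bullet> u = (norm u)\<^sup>2"
      unfolding ly by (simp add: inner_add_left uy power2_norm_eq_inner)
    ultimately have "norm u * norm u \<le> \<rho> * norm u" by (simp add: power2_eq_square)
    then have u_le: "norm u \<le> \<rho>" using \<rho>(1) by (cases "u = 0") auto
    have y_ge: "norm l / 2 \<le> norm y"
      using norm_triangle_ineq[of u y] u_le \<rho>(2) unfolding ly[symmetric] by simp
    have y0: "norm y > 0" using y_ge l0 by (auto intro: less_le_trans[of _ "norm l / 2"])
    have "- (u \<bullet> f' a y) \<le> norm u * norm (f' a y)"
      using Cauchy_Schwarz_ineq2[of u "f' a y"] by simp
    also have "\<dots> \<le> \<rho> * (n * norm y)"
      unfolding n_def using u_le \<rho>(1) by (intro mult_mono norm_blinfun) auto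
    also have "\<dots> \<le> - k / 8 * norm l * norm y"
      using mult_right_mono[OF \<rho>(3), of "norm y"] by (simp add: mult.assoc)
    also have "\<dots> \<le> - k / 8 * (2 * norm y) * norm y"
      using y_ge k by (intro mult_right_mono mult_left_mono) auto
    finally have uAy: "- (u \<bullet> f' a y) \<le> - k / 4 * (norm y)\<^sup>2"
      by (simp add: power2_eq_square)
    have "l \<bullet> (A *v y) = k * (norm y)\<^sup>2"
      unfolding l by (subst ly) (simp add: inner_add_left uy power2_norm_eq_inner)
    then have "y \<bullet> f' a y = k * (norm y)\<^sup>2 - u \<bullet> f' a y"
      by (simp add: u_def A(1) inner_diff_left)
    then have yAy: "y \<bullet> f' a y \<le> 3 * k / 4 * (norm y)\<^sup>2"
      using uAy by simp
    have q0: "q \<noteq> 0" using y0 unfolding y_def by auto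
    have Vy: "V s = (e s / q) *\<^sub>R y" unfolding V_eq y_def N_def[symmetric] using q0 by simp
    have "V s \<bullet> f' a (V s) = (e s / q)\<^sup>2 * (y \<bullet> f' a y)"
      unfolding Vy by (simp add: blinfun.scaleR_right power2_eq_square)
    also have "\<dots> \<le> (e s / q)\<^sup>2 * (3 * k / 4 * (norm y)\<^sup>2)"
      by (intro mult_left_mono yAy) simp
    also have "\<dots> = 3 * k / 4 * (norm (V s))\<^sup>2"
      unfolding Vy by (simp add: power_mult_distrib power_divide mult_ac)
    finally have 1: "V s \<bullet> f' a (V s) \<le> 3 * k / 4 * (norm (V s))\<^sup>2" .
    have "V s \<bullet> (f' (X s \<alpha>) - f' a) (V s) \<le> norm (V s) * norm ((f' (X s \<alpha>) - f' a) (V s))"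
      by (rule norm_cauchy_schwarz)
    also have "\<dots> \<le> norm (V s) * (- k / 4 * norm (V s))"
      by (intro mult_left_mono order.trans[OF norm_blinfun] mult_right_mono f'_near s) auto
    finally have "V s \<bullet> (f' (X s \<alpha>) - f' a) (V s) \<le> - k / 4 * (norm (V s))\<^sup>2"
      by (simp add: power2_eq_square algebra_simps)
    then show ?thesis
      using 1 by (simp add: blinfun.diff_left inner_diff_right algebra_simps)
  qed
  \<comment> \<open>The adjoint equation gives (|V|^2)' = -2 V . f' V >= -k |V|^2. As
    \<open>k\<close> is negative, |V|^2 is bounded by a multiple of e^(-k s), which tends to 0
    backward in time.\<close>
  have mono: "(norm (V s))\<^sup>2 * exp (k * s) \<le> (norm (V T))\<^sup>2 * exp (k * T)" if "s \<le> T" for s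
  proof (rule DERIV_nonneg_imp_nondecreasing[OF that])
    fix x assume "s \<le> x" "x \<le> T"
    have "((\<lambda>s. V s \<bullet> V s) has_vector_derivative V x \<bullet> V' x + V' x \<bullet> V x) (at x)"
      by (rule bounded_bilinear.has_vector_derivative[OF bounded_bilinear_inner V(1) V(1)])
    then have dV: "((\<lambda>s. (norm (V s))\<^sup>2) has_real_derivative - 2 * (V x \<bullet> f' (X x \<alpha>) (V x))) (at x)"
      by (simp add: has_real_derivative_iff_has_vector_derivative power2_norm_eq_inner V(2) inner_commute[of "V x" "V' x"])
    have "((\<lambda>s. exp (k * s)) has_real_derivative exp (k * x) * k) (at x)"
      by (auto intro!: derivative_eq_intros)
    from DERIV_mult[OF dV this]
    have "((\<lambda>s. (norm (V s))\<^sup>2 * exp (k * s)) has_real_derivative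
        - 2 * (V x \<bullet> f' (X x \<alpha>) (V x)) * exp (k * x) + (norm (V x))\<^sup>2 * (exp (k * x) * k)) (at x)"
      by (simp add: mult.commute)
    moreover have "- 2 * (V x \<bullet> f' (X x \<alpha>) (V x)) * exp (k * x) + (norm (V x))\<^sup>2 * (exp (k * x) * k)
      = 2 * exp (k * x) * (k / 2 * (norm (V x))\<^sup>2 - V x \<bullet> f' (X x \<alpha>) (V x))"
      by (simp add: algebra_simps)
    moreover have "\<dots> \<ge> 0" using VAV[OF \<open>x \<le> T\<close>] by (intro mult_nonneg_nonneg) auto
    ultimately show "\<exists>y. ((\<lambda>s. (norm (V s))\<^sup>2 * exp (k * s)) has_real_derivative y) (at x) \<and> 0 \<le> y" by auto
  qed
  have "norm (V s) \<le> norm (V T) * exp (k / 2 * T) * exp (- k / 2 * s)" if "s \<le> T" for s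
  proof (rule power2_le_imp_le)
    have sq: "(exp (r / 2 * t))\<^sup>2 = exp (r * t)" for r t :: real
      by (simp add: power2_eq_square exp_add[symmetric])
    have "(norm (V s))\<^sup>2 = (norm (V s))\<^sup>2 * exp (k * s) * exp (- k * s)"
      by (simp add: mult.assoc exp_add[symmetric])
    also have "\<dots> \<le> (norm (V T))\<^sup>2 * exp (k * T) * exp (- k * s)"
      by (intro mult_right_mono mono that) simp
    finally show "(norm (V s))\<^sup>2 \<le> (norm (V T) * exp (k / 2 * T) * exp (- k / 2 * s))\<^sup>2"
      by (simp only: power_mult_distrib sq)
  qed simp
  then show ?thesis using that[of "- k / 2"] k by auto
qed

text \<open>Integrating the flow equation in time and differentiating in the label under the
  integral sign yields the variational equation for \<open>Xa\<close> without exchanging second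
  derivatives of the parametrization.\<close>

lemma flow_parameter_derivative:
  fixes f :: "'a::euclidean_space \<Rightarrow> 'a" and f' :: "'a \<Rightarrow> 'a \<Rightarrow>\<^sub>L 'a" and X :: "real \<Rightarrow> real \<Rightarrow> 'a"
  assumes \<Omega>: "open \<Omega>" and X\<Omega>: "\<And>s \<alpha>. X s \<alpha> \<in> \<Omega>"
    and f': "\<And>x. x \<in> \<Omega> \<Longrightarrow> (f has_derivative f' x) (at x)" and contf': "continuous_on \<Omega> f'"
    and flow: "\<And>s \<alpha>. ((\<lambda>s. X s \<alpha>) has_vector_derivative f (X s \<alpha>)) (at s)"
    and X: "C2_on (\<lambda>(s, \<alpha>). X s \<alpha>) UNIV"
  obtains Xa where
    "\<forall>s \<alpha>. ((\<lambda>(s, \<alpha>). X s \<alpha>) has_derivative (\<lambda>(u, v). u *\<^sub>R f (X s \<alpha>) + v *\<^sub>R Xa s \<alpha>)) (at (s, \<alpha>))"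
    "\<forall>s \<alpha>. (X s has_vector_derivative Xa s \<alpha>) (at \<alpha>)"
    "\<forall>s \<alpha>. ((\<lambda>s. Xa s \<alpha>) has_vector_derivative f' (X s \<alpha>) (Xa s \<alpha>)) (at s)"
proof -
  let ?X = "\<lambda>(s, \<alpha>). X s \<alpha>"
  obtain D :: "real \<times> real \<Rightarrow> (real \<times> real) \<Rightarrow>\<^sub>L 'a" and D' :: "real \<times> real \<Rightarrow> (real \<times> real) \<Rightarrow>\<^sub>L (real \<times> real) \<Rightarrow>\<^sub>L 'a"
    where "\<forall>z\<in>UNIV. (?X has_derivative D z) (at z)" "\<forall>z\<in>UNIV. (D has_derivative D' z) (at z)"
    using X unfolding C2_on_def by auto
  then have D: "(?X has_derivative D z) (at z)" "(D has_derivative D' z) (at z)" for z by blast+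
  define Xa where "Xa s \<alpha> = D (s, \<alpha>) (0, 1)" for s \<alpha>
  have D_s: "D (s, \<alpha>) (1, 0) = f (X s \<alpha>)" for s \<alpha>
  proof -
    have "((\<lambda>s. ?X (s, \<alpha>)) has_derivative (\<lambda>u. D (s, \<alpha>) (u, 0))) (at s)"
      by (rule has_derivative_compose[OF _ D(1)]) (auto intro!: derivative_eq_intros)
    moreover have "(\<lambda>u. D (s, \<alpha>) (u, 0)) = (\<lambda>u. u *\<^sub>R D (s, \<alpha>) (1, 0))"
      by (rule ext) (simp flip: blinfun.scaleR_right)
    ultimately have "((\<lambda>s. X s \<alpha>) has_vector_derivative D (s, \<alpha>) (1, 0)) (at s)"
      unfolding has_vector_derivative_def by (simp only: prod.case)
    then show ?thesis by (rule vector_derivative_unique_at[OF _ flow])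
  qed
  have Xa: "(X s has_vector_derivative Xa s \<alpha>) (at \<alpha>)" for s \<alpha>
  proof -
    have "((\<lambda>\<alpha>. ?X (s, \<alpha>)) has_derivative (\<lambda>v. D (s, \<alpha>) (0, v))) (at \<alpha>)"
      by (rule has_derivative_compose[OF _ D(1)]) (auto intro!: derivative_eq_intros)
    moreover have "D (s, \<alpha>) (0, v) = v *\<^sub>R Xa s \<alpha>" for v
      unfolding Xa_def by (simp flip: blinfun.scaleR_right)
    ultimately show ?thesis by (simp add: has_vector_derivative_def)
  qed
  have D_eq: "blinfun_apply (D (s, \<alpha>)) = (\<lambda>(u, v). u *\<^sub>R f (X s \<alpha>) + v *\<^sub>R Xa s \<alpha>)" for s \<alpha>
  proof
    fix z :: "real \<times> real"
    have "z = fst z *\<^sub>R (1, 0) + snd z *\<^sub>R (0, 1)" by (simp add: prod_eq_iff)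
    then have "D (s, \<alpha>) z = D (s, \<alpha>) (fst z *\<^sub>R (1, 0) + snd z *\<^sub>R (0, 1))" by simp
    then show "D (s, \<alpha>) z = (\<lambda>(u, v). u *\<^sub>R f (X s \<alpha>) + v *\<^sub>R Xa s \<alpha>) z"
      unfolding blinfun.add_right blinfun.scaleR_right D_s Xa_def by (simp add: case_prod_unfold)
  qed
  have contD: "continuous_on UNIV D"
    by (intro continuous_at_imp_continuous_on ballI has_derivative_continuous[OF D(2)])
  have contXa: "continuous_on UNIV (\<lambda>z. Xa (fst z) (snd z))"
    unfolding Xa_def by (auto intro!: continuous_intros contD)
  have "continuous_on UNIV ?X"
    by (intro continuous_at_imp_continuous_on ballI has_derivative_continuous[OF D(1)])
  then have contX: "continuous_on UNIV (\<lambda>z. X (fst z) (snd z))" by (simp add: case_prod_unfold)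
  define w where "w \<alpha> s = f' (X s \<alpha>) (Xa s \<alpha>)" for \<alpha> s
  have contw: "continuous_on UNIV (\<lambda>z. w (fst z) (snd z))"
  proof -
    have sw: "continuous_on UNIV (\<lambda>z. (snd z, fst z :: real) :: real \<times> real)" by (intro continuous_intros)
    have 1: "continuous_on UNIV (\<lambda>z. X (snd z) (fst z))" "continuous_on UNIV (\<lambda>z. Xa (snd z) (fst z))"
      using continuous_on_compose2[OF contX sw] continuous_on_compose2[OF contXa sw] by auto
    have "continuous_on UNIV (\<lambda>z. f' (X (snd z) (fst z)))"
      by (rule continuous_on_compose2[OF contf' 1(1)]) (use X\<Omega> in auto)
    then show ?thesis unfolding w_def using 1(2) by (intro continuous_intros)
  qed
  have contw1: "continuous_on I (w \<alpha>)" for I \<alpha>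
    using continuous_on_compose2[OF contw, of I "\<lambda>s. (\<alpha>, s)"] by (simp add: continuous_intros)
  have contfX: "continuous_on I (\<lambda>s. f (X s \<alpha>))" for I \<alpha>
  proof -
    have "continuous_on \<Omega> f"
      by (intro continuous_at_imp_continuous_on ballI has_derivative_continuous[OF f'])
    moreover have "continuous_on I (\<lambda>s. X s \<alpha>)"
      by (intro continuous_at_imp_continuous_on ballI has_vector_derivative_continuous[OF flow])
    ultimately show ?thesis by (rule continuous_on_compose2) (use X\<Omega> in auto)
  qed
  have Xa_int: "Xa s \<alpha> = Xa s1 \<alpha> + integral {s1..s} (w \<alpha>)" if "s1 \<le> s" for s s1 \<alpha>
  proof -
    have fX: "integral {s1..s} (\<lambda>\<sigma>. f (X \<sigma> \<beta>)) = X s \<beta> - X s1 \<beta>" for \<beta>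
      by (intro integral_unique fundamental_theorem_of_calculus that)
        (auto intro: has_vector_derivative_at_within flow)
    have "((\<lambda>\<beta>. integral (cbox s1 s) (\<lambda>\<sigma>. f (X \<sigma> \<beta>))) has_vector_derivative integral (cbox s1 s) (w \<alpha>))
        (at \<alpha> within UNIV)"
    proof (rule leibniz_rule_vector_derivative)
      show "((\<lambda>\<beta>. f (X \<sigma> \<beta>)) has_vector_derivative w \<beta> \<sigma>) (at \<beta> within UNIV)" for \<beta> \<sigma>
      proof -
        have "(X \<sigma> has_derivative (\<lambda>u. u *\<^sub>R Xa \<sigma> \<beta>)) (at \<beta>)"
          using Xa[of \<sigma> \<beta>] unfolding has_vector_derivative_def .
        from has_derivative_compose[OF this f'[OF X\<Omega>]] show ?thesis
          by (simp add: has_vector_derivative_def w_def blinfun.scaleR_right)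
      qed
      show "(\<lambda>\<sigma>. f (X \<sigma> \<beta>)) integrable_on cbox s1 s" for \<beta>
        by (intro integrable_continuous contfX)
      show "continuous_on (UNIV \<times> cbox s1 s) (\<lambda>(\<beta>, \<sigma>). w \<beta> \<sigma>)"
        using continuous_on_subset[OF contw] by (simp add: case_prod_unfold)
    qed auto
    then have "((\<lambda>\<beta>. X s \<beta> - X s1 \<beta>) has_vector_derivative integral {s1..s} (w \<alpha>)) (at \<alpha>)"
      by (simp add: fX)
    moreover have "((\<lambda>\<beta>. X s \<beta> - X s1 \<beta>) has_vector_derivative Xa s \<alpha> - Xa s1 \<alpha>) (at \<alpha>)"
      by (intro has_vector_derivative_diff Xa)
    ultimately have "integral {s1..s} (w \<alpha>) = Xa s \<alpha> - Xa s1 \<alpha>"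
      by (rule vector_derivative_unique_at)
    then show ?thesis by simp
  qed
  have Xa_s: "((\<lambda>s. Xa s \<alpha>) has_vector_derivative w \<alpha> s) (at s)" for s \<alpha>
  proof -
    \<comment> \<open>Starting the integral at \<open>s - 1\<close> makes \<open>s\<close> an
      interior point, so the derivative is two-sided.\<close>
    have "((\<lambda>r. integral {s - 1..r} (w \<alpha>)) has_vector_derivative w \<alpha> s) (at s within {s - 1..s + 1})"
      by (intro integral_has_vector_derivative contw1) auto
    then have "((\<lambda>r. Xa (s - 1) \<alpha> + integral {s - 1..r} (w \<alpha>)) has_vector_derivative w \<alpha> s) (at s within {s - 1..s + 1})"
      by (auto intro!: derivative_eq_intros)
    then have "((\<lambda>r. Xa r \<alpha>) has_vector_derivative w \<alpha> s) (at s within {s - 1..s + 1})"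
      by (rule has_vector_derivative_transform[rotated 2]) (auto intro: Xa_int)
    moreover have "at s within {s - 1..s + 1} = at s" by (intro at_within_interior) auto
    ultimately show ?thesis by simp
  qed
  show ?thesis
    using that[of Xa] D(1) Xa Xa_s unfolding w_def D_eq[symmetric] by blast
qed

lemma has_derivative_jacobian_eq:
  fixes f :: "real^'n \<Rightarrow> real^'m"
  assumes "(f has_derivative f') (at x)"
  shows "f' v = jacobian f (at x) *v v"
proof -
  have "(f has_derivative (\<lambda>v. jacobian f (at x) *v v)) (at x)"
    using assms jacobian_works differentiable_def by blast
  from has_derivative_unique[OF assms this] show ?thesis by simp
qed

lemma continuous_on_divergence:
  fixes f :: "real^'n \<Rightarrow> real^'n" and f' :: "real^'n \<Rightarrow> ((real^'n) \<Rightarrow>\<^sub>L (real^'n))"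
  assumes f': "\<And>x. x \<in> \<Omega> \<Longrightarrow> (f has_derivative f' x) (at x)" and contf': "continuous_on \<Omega> f'"
  shows "continuous_on \<Omega> (divergence f)"
proof -
  have "divergence f x = (\<Sum>i\<in>UNIV. f' x (axis i 1) $ i)" if "x \<in> \<Omega>" for x
    unfolding divergence_def trace_def
    by (simp add: has_derivative_jacobian_eq[OF f'[OF that]] matrix_vector_mult_basis column_def)
  moreover have "continuous_on \<Omega> (\<lambda>x. \<Sum>i\<in>UNIV. f' x (axis i 1) $ i)"
    by (intro continuous_intros contf')
  ultimately show ?thesis by (simp cong: continuous_on_cong)
qed

text \<open>The factor \<open>exp\<close> removes the divergence term, so that the weighted normal solves the adjoint
  variational equation.\<close>

lemma weighted_normal_adjoint:
  fixes f :: "real^3 \<Rightarrow> real^3" and f' :: "real^3 \<Rightarrow> ((real^3) \<Rightarrow>\<^sub>L (real^3))" and x xa :: "real \<Rightarrow> real^3" and p :: real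
  assumes x\<Omega>: "\<And>s. x s \<in> \<Omega>"
    and f': "\<And>x. x \<in> \<Omega> \<Longrightarrow> (f has_derivative f' x) (at x)" and contf': "continuous_on \<Omega> f'"
    and x: "\<And>s. (x has_vector_derivative f (x s)) (at s)"
    and xa: "\<And>s. (xa has_vector_derivative f' (x s) (xa s)) (at s)"
  defines "V \<equiv> \<lambda>s::real. exp (LBINT \<xi>=ereal s..ereal p. divergence f (x \<xi>)) *\<^sub>R cross3 (f (x s)) (xa s)"
  obtains V' where "\<And>s. (V has_vector_derivative V' s) (at s)" "\<And>s w. V' s \<bullet> w = - (V s \<bullet> f' (x s) w)"
proof -
  let ?q = "\<lambda>s. divergence f (x s)" and ?N = "\<lambda>s. cross3 (f (x s)) (xa s)"
  have contx: "continuous_on I x" for I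
    by (intro continuous_at_imp_continuous_on ballI has_vector_derivative_continuous[OF x])
  have "continuous_on \<Omega> (divergence f)"
    by (rule continuous_on_divergence[OF f' contf'])
  then have contq: "continuous_on I ?q" for I
    by (rule continuous_on_compose2[OF _ contx]) (use x\<Omega> in auto)
  \<comment> \<open>An antiderivative on the whole line turns the oriented integral into
    \<open>F p - F s\<close> for either order of \<open>s\<close> and \<open>p\<close>.\<close>
  then obtain F where F: "\<And>s. (F has_vector_derivative ?q s) (at s)"
    using einterval_antiderivative[of "- \<infinity>" \<infinity> ?q] continuous_on_eq_continuous_at[of UNIV ?q] by auto
  have LB: "(LBINT \<xi>=ereal s..ereal p. ?q \<xi>) = F p - F s" for s :: real
    by (rule interval_integral_FTC_finite[OF contq]) (rule has_vector_derivative_at_within[OF F])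
  define E where "E s = exp (F p - F s)" for s
  have E: "(E has_real_derivative - (?q s * E s)) (at s)" for s
    using F[of s] unfolding E_def[abs_def] has_real_derivative_iff_has_vector_derivative[symmetric]
    by (auto intro!: derivative_eq_intros)
  have V: "V = (\<lambda>s. E s *\<^sub>R ?N s)" unfolding V_def LB E_def ..
  define V' where "V' s = E s *\<^sub>R (cross3 (f (x s)) (f' (x s) (xa s)) + cross3 (f' (x s) (f (x s))) (xa s))
      + (- (?q s * E s)) *\<^sub>R ?N s" for s
  have "((\<lambda>s. f (x s)) has_vector_derivative f' (x s) (f (x s))) (at s)" for s
    using has_derivative_compose[OF x[of s, unfolded has_vector_derivative_def] f'[OF x\<Omega>]]
    by (simp add: has_vector_derivative_def blinfun.scaleR_right)
  then have "(?N has_vector_derivative cross3 (f (x s)) (f' (x s) (xa s)) + cross3 (f' (x s) (f (x s))) (xa s)) (at s)" for s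
    by (rule bounded_bilinear.has_vector_derivative[OF bilinear_conv_bounded_bilinear[THEN iffD1, OF bilinear_cross] _ xa])
  then have "(V has_vector_derivative V' s) (at s)" for s
    unfolding V V'_def by (rule has_vector_derivative_scaleR[OF E])
  moreover have "V' s \<bullet> w = - (V s \<bullet> f' (x s) w)" for s w
  proof -
    let ?J = "jacobian f (at (x s))"
    have J: "f' (x s) v = ?J *v v" for v by (rule has_derivative_jacobian_eq[OF f'[OF x\<Omega>]])
    have "V' s = - (E s *\<^sub>R (transpose ?J *v ?N s))"
      using cross3_linear_trace[of ?J "f (x s)" "xa s"]
      unfolding V'_def J divergence_def by (simp add: algebra_simps flip: scaleR_add_right)
    then show ?thesis unfolding V J by (simp add: dot_lmul_matrix inner_commute[of "_ *v _"] matrix_vector_mul_assoc dot_matrix_vector_mul flip: vector_transpose_matrix)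
  qed
  ultimately show ?thesis by (rule that)
qed

subsection \<open>First-order expansion along a half-line\<close>

text \<open>Convergence over an unbounded set is tested on compact intervals containing a ball about
  0, and such balls are symmetric. This exchanges integrals over \<open>{p..}\<close> and
  \<open>{..- p}\<close>.\<close>

lemma has_integral_reflect_set:
  fixes f :: "real \<Rightarrow> 'a::euclidean_space"
  assumes "(f has_integral I) S"
  shows "((\<lambda>x. f (- x)) has_integral I) (uminus ` S)"
proof -
  let ?F = "\<lambda>x. if x \<in> S then f x else 0"
  have eq: "(\<lambda>x. if x \<in> uminus ` S then f (- x) else 0) = (\<lambda>x. ?F (- x))"
    by (force simp: fun_eq_iff)
  have int: "?F integrable_on {a..b}" for a b
    using assms by (subst (asm) has_integral_alt') auto
  have bnd: "\<exists>B>0. \<forall>a b. ball 0 B \<subseteq> {a..b} \<longrightarrow> norm (integral {a..b} ?F - I) < e" if "e > 0" for e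
    using assms that by (subst (asm) has_integral_alt') auto
  have "(\<lambda>x. ?F (- x)) integrable_on {a..b}" for a b
    using int[of "- b" "- a"] Henstock_Kurzweil_Integration.integrable_reflect_real[where f="\<lambda>x. ?F x" and a="-b" and b="-a"] by simp
  moreover have "\<exists>B>0. \<forall>a b. ball 0 B \<subseteq> {a..b} \<longrightarrow> norm (integral {a..b} (\<lambda>x. ?F (- x)) - I) < e"
    if e: "e > 0" for e
  proof -
    obtain B where B: "B > 0" "\<And>a b. ball 0 B \<subseteq> {a..b} \<Longrightarrow> norm (integral {a..b} ?F - I) < e"
      using bnd[OF e] by blast
    have "norm (integral {a..b} (\<lambda>x. ?F (- x)) - I) < e" if "ball 0 B \<subseteq> {a..b}" for a b
    proof -
      have "ball 0 B \<subseteq> {- b..- a}"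
      proof
        fix x :: real assume "x \<in> ball 0 B"
        then have "- x \<in> ball 0 B" by simp
        then have "- x \<in> {a..b}" using that by blast
        then show "x \<in> {- b..- a}" by auto
      qed
      from B(2)[OF this] show ?thesis
        using Henstock_Kurzweil_Integration.integral_reflect_real[where f="?F" and a="-b" and b="-a"] by simp
    qed
    then show ?thesis using B(1) by blast
  qed
  ultimately show ?thesis
    unfolding has_integral_alt'[of "\<lambda>x. f (- x)"] eq by auto
qed

lemma has_integral_exp_from_minus_infinity:
  fixes c p :: real
  assumes "c > 0"
  shows "((\<lambda>s. exp (c * s)) has_integral exp (c * p) / c) {..p}"
proof -
  have "uminus ` {- p..} = {..p}" by (auto intro: image_eqI[of _ _ "- x" for x])
  then show ?thesis
    using has_integral_reflect_set[OF has_integral_exp_minus_to_infinity[OF assms, of "- p"]] by simp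
qed

text \<open>\<open>f''\<close> may be unbounded on \<Omega>, but it is bounded on a compact
  neighbourhood of \<open>S\<close>. The mean value inequality, applied to \<open>f'\<close> and
  then to \<open>f\<close>, gives one constant for all base points.\<close>

lemma uniform_quadratic_remainder:
  fixes f :: "'a::euclidean_space \<Rightarrow> 'b::real_normed_vector"
    and f' :: "'a \<Rightarrow> 'a \<Rightarrow>\<^sub>L 'b" and f'' :: "'a \<Rightarrow> 'a \<Rightarrow>\<^sub>L 'a \<Rightarrow>\<^sub>L 'b"
  assumes "compact S" "open \<Omega>" "S \<subseteq> \<Omega>"
    and f': "\<And>x. x \<in> \<Omega> \<Longrightarrow> (f has_derivative f' x) (at x)"
    and f'': "\<And>x. x \<in> \<Omega> \<Longrightarrow> (f' has_derivative f'' x) (at x)"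
    and cont: "continuous_on \<Omega> f''"
  obtains \<delta> M where "\<delta> > 0" "M \<ge> 0" "\<And>x. x \<in> S \<Longrightarrow> cball x \<delta> \<subseteq> \<Omega>"
    "\<And>x y. x \<in> S \<Longrightarrow> dist x y \<le> \<delta> \<Longrightarrow> norm (f y - f x - f' x (y - x)) \<le> M * (norm (y - x))\<^sup>2"
proof -
  obtain \<delta> where \<delta>: "\<delta> > 0" "(\<Union>x\<in>S. cball x \<delta>) \<subseteq> \<Omega>"
    using compact_subset_open_imp_cball_epsilon_subset[OF assms(1-3)] by blast
  define T where "T = {x + y | x y. x \<in> S \<and> y \<in> cball 0 \<delta>}"
  have cb: "cball x \<delta> \<subseteq> T" if "x \<in> S" for x
  proof
    fix y assume "y \<in> cball x \<delta>"
    then have "y - x \<in> cball 0 \<delta>" "y = x + (y - x)" by (auto simp: dist_norm norm_minus_commute)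
    then show "y \<in> T" unfolding T_def using that by blast
  qed
  have TO: "T \<subseteq> \<Omega>"
  proof
    fix z assume "z \<in> T"
    then obtain x y where "z = x + y" "x \<in> S" "norm y \<le> \<delta>" unfolding T_def by auto
    then have "z \<in> cball x \<delta>" "x \<in> S" by (auto simp: dist_norm)
    then show "z \<in> \<Omega>" using \<delta>(2) by blast
  qed
  have "compact T"
    unfolding T_def by (intro compact_sums assms compact_cball)
  then have "compact (f'' ` T)"
    by (intro compact_continuous_image continuous_on_subset[OF cont TO])
  then obtain M where M: "\<And>x. x \<in> T \<Longrightarrow> norm (f'' x) \<le> M" "M > 0"
    using compact_imp_bounded[of "f'' ` T"] unfolding bounded_pos by auto
  have rem: "norm (f y - f x - f' x (y - x)) \<le> M * (norm (y - x))\<^sup>2" if x: "x \<in> S" and y: "dist x y \<le> \<delta>" for x y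
  proof -
    \<comment> \<open>With radius exactly \<open>norm (y - x)\<close>, the variation of
      \<open>f'\<close> on the ball supplies the second factor \<open>norm (y - x)\<close>.\<close>
    let ?B = "cball x (norm (y - x))"
    have sub: "?B \<subseteq> T"
      using cb[OF x] y by (auto simp: dist_norm norm_minus_commute)
    have lip: "norm (f' z - f' x) \<le> M * norm (y - x)" if z: "z \<in> ?B" for z
    proof -
      have "norm (f' z - f' x) \<le> M * norm (z - x)"
      proof (rule differentiable_bound[of ?B])
        show "(f' has_derivative f'' u) (at u within ?B)" if "u \<in> ?B" for u
          using f'' that sub TO has_derivative_at_withinI by blast
        show "onorm (f'' u) \<le> M" if "u \<in> ?B" for u
          using M(1) that sub by (auto simp: norm_blinfun.rep_eq[symmetric])
      qed (use z in auto)
      also have "\<dots> \<le> M * norm (y - x)"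
        using z M(2) by (intro mult_left_mono) (auto simp: dist_norm norm_minus_commute)
      finally show ?thesis .
    qed
    have "norm (f y - f x - f' x (y - x)) \<le> norm (y - x) * (M * norm (y - x))"
    proof (rule differentiable_bound_linearization[of x y ?B f "\<lambda>z. blinfun_apply (f' z)" x])
      show "x + t *\<^sub>R (y - x) \<in> ?B" if "t \<in> {0..1}" for t
        using that by (auto simp: dist_norm mult_left_le_one_le)
      show "(f has_derivative f' u) (at u within ?B)" if "u \<in> ?B" for u
        using f' that sub TO has_derivative_at_withinI by blast
      show "onorm (blinfun_apply (f' u) - blinfun_apply (f' x)) \<le> M * norm (y - x)" if "u \<in> ?B" for u
        using lip[OF that] by (simp add: norm_blinfun.rep_eq minus_blinfun.rep_eq fun_diff_def)
    qed auto
    then show ?thesis by (simp add: power2_eq_square algebra_simps)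
  qed
  show ?thesis
    using \<delta> M(2) rem by (intro that[of \<delta> M]) auto
qed

text \<open>Comparison with \<open>C * exp (c * s)\<close>; the tail bound is the integral of this
  majorant up to \<open>q\<close>. Integrability enters on compact intervals ending at
  \<open>p\<close>, the form in which the perturbed solutions will provide it.\<close>

lemma integrable_on_halfline_exp_bound:
  fixes h :: "real \<Rightarrow> real"
  assumes "c > 0" and int: "\<And>q. q \<le> p \<Longrightarrow> h integrable_on {q..p}"
    and bnd: "\<And>s. s \<le> p \<Longrightarrow> \<bar>h s\<bar> \<le> C * exp (c * s)"
  shows "h integrable_on {..p}"
    and "q \<le> p \<Longrightarrow> \<bar>integral {..p} h - integral {q..p} h\<bar> \<le> C * exp (c * q) / c"
proof -
  have I: "((\<lambda>s. C * exp (c * s)) has_integral C * (exp (c * r) / c)) {..r}" for r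
    using has_integral_exp_from_minus_infinity[OF \<open>c > 0\<close>, of r] by (rule has_integral_mult_right)
  have sub: "h integrable_on {q..r}" if "r \<le> p" for q r
  proof (cases "q \<le> r")
    case True
    then show ?thesis using int[of q] that by (auto intro: integrable_on_subinterval)
  qed auto
  have half: "h integrable_on {..r}" if r: "r \<le> p" for r
  proof (rule integrable_on_all_intervals_integrable_bound)
    show "(\<lambda>x. if x \<in> {..r} then h x else 0) integrable_on cbox a b" for a b
    proof -
      have "{..r} \<inter> {a..b} = {a..min b r}" by auto
      then show ?thesis
        using sub[of "min b r" a] r by (simp only: integrable_restrict_Int cbox_interval)
    qed
    show "norm (h x) \<le> C * exp (c * x)" if "x \<in> {..r}" for x using bnd that r by auto
    show "(\<lambda>s. C * exp (c * s)) integrable_on {..r}" using I by blast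
  qed
  show "h integrable_on {..p}" using half by simp
  assume q: "q \<le> p"
  have "(h has_integral (integral {..q} h + integral {q..p} h)) ({..q} \<union> {q..p})"
  proof (rule has_integral_Un)
    have "{..q} \<inter> {q..p} = {q}" using q by auto
    then show "negligible ({..q} \<inter> {q..p})" by simp
  qed (use half[OF q] sub[of p q] in auto)
  moreover have "{..q} \<union> {q..p} = {..p}" using q by auto
  ultimately have "integral {..p} h = integral {..q} h + integral {q..p} h"
    by (simp add: integral_unique)
  moreover have "norm (integral {..q} h) \<le> integral {..q} (\<lambda>s. C * exp (c * s))"
    using half[OF q] I[of q] bnd q by (intro integral_norm_bound_integral) auto
  ultimately show "\<bar>integral {..p} h - integral {q..p} h\<bar> \<le> C * exp (c * q) / c"
    using integral_unique[OF I[of q]] by simp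
qed

text \<open>\<open>G\<close> need not be measurable in its time argument. Integrability comes from the solutions \<open>Y\<close>: up to
  a uniform \<open>O(\<epsilon>)\<close> error the integrand is \<open>1/\<epsilon>\<close> times the derivative of \<open>V \<bullet> (Y - X)\<close>.\<close>

lemma decaying_adjoint_pairing:
  fixes f :: "'a::euclidean_space \<Rightarrow> 'a" and f' :: "'a \<Rightarrow> 'a \<Rightarrow>\<^sub>L 'a" and f'' :: "'a \<Rightarrow> 'a \<Rightarrow>\<^sub>L 'a \<Rightarrow>\<^sub>L 'a"
    and G :: "'a \<Rightarrow> real \<Rightarrow> 'a" and G' :: "real \<Rightarrow> 'a \<Rightarrow> 'a \<Rightarrow> 'a" and X V V' :: "real \<Rightarrow> 'a"
  assumes \<Omega>: "open \<Omega>" "a \<in> \<Omega>"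
    and f': "\<And>x. x \<in> \<Omega> \<Longrightarrow> (f has_derivative f' x) (at x)"
    and f'': "\<And>x. x \<in> \<Omega> \<Longrightarrow> (f' has_derivative f'' x) (at x)" and cont: "continuous_on \<Omega> f''"
    and G': "\<And>s x. x \<in> \<Omega> \<Longrightarrow> ((\<lambda>x. G x s) has_derivative G' s x) (at x)"
    and G'_le: "\<And>s x. x \<in> \<Omega> \<Longrightarrow> onorm (G' s x) \<le> L" and G_le: "\<And>s x. x \<in> \<Omega> \<Longrightarrow> norm (G x s) \<le> B"
    and X: "\<And>s. (X has_vector_derivative f (X s)) (at s)" "\<And>s. X s \<in> \<Omega>" "(X \<longlongrightarrow> a) at_bot"
    and V: "\<And>s. (V has_vector_derivative V' s) (at s)" "\<And>s w. V' s \<bullet> w = - (V s \<bullet> f' (X s) w)"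
    and decay: "c > 0" "\<And>s. s \<le> S \<Longrightarrow> norm (V s) \<le> C * exp (c * s)"
    and "0 < e"
    and Y: "\<And>\<epsilon>. 0 \<le> \<epsilon> \<Longrightarrow> \<epsilon> \<le> e \<Longrightarrow> \<exists>Y. Y p = Z \<epsilon> \<and>
        (\<forall>s\<le>p. Y s \<in> \<Omega> \<and> (Y has_vector_derivative f (Y s) + \<epsilon> *\<^sub>R G (Y s) s) (at s within {..p})
                \<and> norm (Y s - X s) \<le> K * \<epsilon>)"
  shows "(\<lambda>s. V s \<bullet> G (X s) s) integrable_on {..p}"
    and "\<exists>D. \<forall>\<^sub>F \<epsilon> in at_right 0.
      \<bar>V p \<bullet> (Z \<epsilon> - X p) - \<epsilon> * integral {..p} (\<lambda>s. V s \<bullet> G (X s) s)\<bar> \<le> D * \<epsilon>\<^sup>2"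
proof -
  let ?h = "\<lambda>s. V s \<bullet> G (X s) s"
  have contX: "continuous_on T X" and contV: "continuous_on T V" for T
    by (meson X(1) V(1) continuous_at_imp_continuous_on has_vector_derivative_continuous)+
  have L: "L \<ge> 0" using G'_le[OF \<Omega>(2)] onorm_pos_le[OF has_derivative_bounded_linear[OF G'[OF \<Omega>(2)]]] 
    by (meson order.trans)
  have B: "B \<ge> 0" using G_le[OF \<Omega>(2)] norm_ge_zero order.trans by blast
  \<comment> \<open>The decay is known for \<open>s \<le> S\<close> only; on the compact remainder
    up to \<open>p\<close> the continuous \<open>V\<close> is bounded, and a larger constant covers
    both.\<close>
  obtain C1 where C1: "C1 > 0" "\<And>s. s \<le> p \<Longrightarrow> norm (V s) \<le> C1 * exp (c * s)"
  proof -
    have "bounded (V ` {S..p})"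
      by (intro compact_imp_bounded compact_continuous_image contV) simp
    then obtain M where M: "M > 0" "\<And>s. S \<le> s \<Longrightarrow> s \<le> p \<Longrightarrow> norm (V s) \<le> M"
      unfolding bounded_pos by auto
    let ?C = "\<bar>C\<bar> + M * exp (- c * S)"
    have "norm (V s) \<le> ?C * exp (c * s)" if "s \<le> p" for s
    proof (cases "s \<le> S")
      case True
      have "norm (V s) \<le> C * exp (c * s)" by (rule decay(2)[OF True])
      also have "\<dots> \<le> ?C * exp (c * s)"
        using M(1) by (intro mult_right_mono) (auto intro: add_increasing2)
      finally show ?thesis .
    next
      case False
      have "norm (V s) \<le> M * 1" using M(2) False that by simp
      also have "\<dots> \<le> M * exp (c * (s - S))"
        using M(1) False decay(1) by (intro mult_left_mono) auto
      also have "\<dots> = M * exp (- c * S) * exp (c * s)"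
        by (simp add: exp_add[symmetric] algebra_simps)
      also have "\<dots> \<le> ?C * exp (c * s)" by (intro mult_right_mono) auto
      finally show ?thesis .
    qed
    moreover have "?C > 0" using M(1) by (intro add_nonneg_pos) auto
    ultimately show thesis using that by blast
  qed
  obtain r where r: "r > 0" "cball a r \<subseteq> \<Omega>"
    using \<Omega> open_contains_cball by blast
  obtain s2 where s2: "\<And>s. s \<le> s2 \<Longrightarrow> dist (X s) a < r"
    using tendstoD[OF X(3) r(1)] unfolding eventually_at_bot_linorder by blast
  \<comment> \<open>A compact set containing the whole backward orbit: a ball around its limit and a
    finite arc.\<close>
  define S0 where "S0 = cball a r \<union> X ` {s2..p}"
  have S0: "compact S0" "S0 \<subseteq> \<Omega>"
    unfolding S0_def using r(2) X(2) by (auto intro!: compact_Un compact_continuous_image contX)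
  have XS0: "X s \<in> S0" if "s \<le> p" for s
    using s2[of s] that unfolding S0_def by (cases "s \<le> s2") (auto simp: dist_commute intro: less_imp_le)
  obtain \<delta> M where \<delta>: "\<delta> > 0" and M: "M \<ge> 0" and cb: "\<And>x. x \<in> S0 \<Longrightarrow> cball x \<delta> \<subseteq> \<Omega>"
    and rem: "\<And>x y. x \<in> S0 \<Longrightarrow> dist x y \<le> \<delta> \<Longrightarrow> norm (f y - f x - f' x (y - x)) \<le> M * (norm (y - x))\<^sup>2"
    using uniform_quadratic_remainder[OF S0(1) \<Omega>(1) S0(2) f' f'' cont] by metis
  \<comment> \<open>\<open>M * K\<^sup>2\<close> comes from the quadratic remainder of
    \<open>f\<close>, \<open>L * \<bar>K\<bar>\<close> from replacing \<open>G\<close> at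
    \<open>Y\<close> by \<open>G\<close> at \<open>X\<close>.\<close>
  define D where "D = M * K\<^sup>2 + L * \<bar>K\<bar>"
  have D: "D \<ge> 0" unfolding D_def using M L by simp
  \<comment> \<open>For \<open>\<epsilon> \<le> e1\<close> the perturbed orbit stays within
    \<open>\<delta>\<close> of \<open>X\<close>; \<open>\<bar>K\<bar> + 1\<close> is positive
    whatever \<open>K\<close> is.\<close>
  define e1 where "e1 = min e (\<delta> / (\<bar>K\<bar> + 1))"
  have e1: "e1 > 0" unfolding e1_def using \<open>0 < e\<close> \<delta> by (simp add: add_nonneg_pos)
  have key: "\<exists>\<phi> \<phi>'. \<phi> p = V p \<bullet> (Z \<epsilon> - X p) \<and> (\<forall>s\<le>p. (\<phi> has_vector_derivative \<phi>' s) (at s within {..p})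
       \<and> \<bar>\<phi> s\<bar> \<le> C1 * exp (c * s) * (\<bar>K\<bar> * \<epsilon>) \<and> \<bar>\<phi>' s - \<epsilon> * ?h s\<bar> \<le> C1 * exp (c * s) * (D * \<epsilon>\<^sup>2))"
    if \<epsilon>: "0 < \<epsilon>" "\<epsilon> \<le> e1" for \<epsilon>
  proof -
    obtain Y where Yp: "Y p = Z \<epsilon>" and Y\<Omega>: "\<And>s. s \<le> p \<Longrightarrow> Y s \<in> \<Omega>"
      and Y': "\<And>s. s \<le> p \<Longrightarrow> (Y has_vector_derivative f (Y s) + \<epsilon> *\<^sub>R G (Y s) s) (at s within {..p})"
      and YK: "\<And>s. s \<le> p \<Longrightarrow> norm (Y s - X s) \<le> K * \<epsilon>"
      using Y[of \<epsilon>] \<epsilon> unfolding e1_def by auto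
    \<comment> \<open>In the derivative of \<open>\<phi>\<close> the linear part
      \<open>f' (X s) (Y s - X s)\<close> cancels against \<open>V'\<close>, which leaves
      \<open>\<epsilon> * ?h s\<close> and terms of second order in
      \<open>\<epsilon>\<close>.\<close>
    define \<phi> where "\<phi> s = V s \<bullet> (Y s - X s)" for s
    define \<phi>' where "\<phi>' s = V s \<bullet> (f (Y s) + \<epsilon> *\<^sub>R G (Y s) s - f (X s)) + V' s \<bullet> (Y s - X s)" for s
    have z: "norm (Y s - X s) \<le> \<bar>K\<bar> * \<epsilon>" if "s \<le> p" for s
      using YK[OF that] \<epsilon>(1) by (meson abs_ge_self less_imp_le mult_right_mono order.trans)
    have z\<delta>: "dist (X s) (Y s) \<le> \<delta>" if "s \<le> p" for s
    proof -
      have "norm (Y s - X s) \<le> \<bar>K\<bar> * (\<delta> / (\<bar>K\<bar> + 1))"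
        using z[OF that] \<epsilon> unfolding e1_def by (meson abs_ge_zero min.boundedE mult_left_mono order.trans)
      also have "\<dots> \<le> \<delta>" using \<delta> by (simp add: field_simps add_pos_nonneg)
      finally show ?thesis by (simp add: dist_norm norm_minus_commute)
    qed
    have 1: "(\<phi> has_vector_derivative \<phi>' s) (at s within {..p})" if "s \<le> p" for s
      unfolding \<phi>_def \<phi>'_def
      by (rule bounded_bilinear.has_vector_derivative[OF bounded_bilinear_inner])
        (intro has_vector_derivative_at_within[OF V(1)] has_vector_derivative_diff Y'[OF that]
          has_vector_derivative_at_within[OF X(1)])+
    have V_le: "\<bar>V s \<bullet> w\<bar> \<le> C1 * exp (c * s) * q" if "s \<le> p" "norm w \<le> q" for s w q
      by (rule order.trans[OF Cauchy_Schwarz_ineq2]) (use C1 that in \<open>auto intro!: mult_mono\<close>)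
    have 2: "\<bar>\<phi> s\<bar> \<le> C1 * exp (c * s) * (\<bar>K\<bar> * \<epsilon>)" if "s \<le> p" for s
      unfolding \<phi>_def by (rule V_le[OF that z[OF that]])
    have 3: "\<bar>\<phi>' s - \<epsilon> * ?h s\<bar> \<le> C1 * exp (c * s) * (D * \<epsilon>\<^sup>2)" if s: "s \<le> p" for s
    proof -
      have g: "norm (G (Y s) s - G (X s) s) \<le> L * norm (Y s - X s)"
      proof (rule differentiable_bound[of "cball (X s) \<delta>" "\<lambda>x. G x s" "G' s"])
        show "((\<lambda>x. G x s) has_derivative G' s x) (at x within cball (X s) \<delta>)" if "x \<in> cball (X s) \<delta>" for x
          using G' cb[OF XS0[OF s]] that has_derivative_at_withinI by blast
        show "onorm (G' s x) \<le> L" if "x \<in> cball (X s) \<delta>" for x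
          using G'_le cb[OF XS0[OF s]] that by blast
      qed (use z\<delta>[OF s] \<delta> in auto)
      have "\<phi>' s - \<epsilon> * ?h s = V s \<bullet> ((f (Y s) - f (X s) - f' (X s) (Y s - X s)) + \<epsilon> *\<^sub>R (G (Y s) s - G (X s) s))"
        unfolding \<phi>'_def V(2) by (simp add: algebra_simps)
      also have "\<bar>\<dots>\<bar> \<le> C1 * exp (c * s) * (M * (\<bar>K\<bar> * \<epsilon>)\<^sup>2 + \<epsilon> * (L * (\<bar>K\<bar> * \<epsilon>)))"
      proof (rule V_le[OF s], rule norm_triangle_le, rule add_mono)
        show "norm (f (Y s) - f (X s) - f' (X s) (Y s - X s)) \<le> M * (\<bar>K\<bar> * \<epsilon>)\<^sup>2"
          by (rule order.trans[OF rem[OF XS0[OF s] z\<delta>[OF s]]]) (intro mult_left_mono power_mono z s M norm_ge_zero)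
        show "norm (\<epsilon> *\<^sub>R (G (Y s) s - G (X s) s)) \<le> \<epsilon> * (L * (\<bar>K\<bar> * \<epsilon>))"
          using g z[OF s] L \<epsilon>(1) by (auto intro!: mult_left_mono intro: order.trans)
      qed
      also have "M * (\<bar>K\<bar> * \<epsilon>)\<^sup>2 + \<epsilon> * (L * (\<bar>K\<bar> * \<epsilon>)) = D * \<epsilon>\<^sup>2"
        by (simp add: D_def power2_eq_square algebra_simps)
      finally show ?thesis .
    qed
    show ?thesis
      by (rule exI[of _ \<phi>], rule exI[of _ \<phi>']) (use 1 2 3 Yp in \<open>auto simp: \<phi>_def\<close>)
  qed
  \<comment> \<open>The gauge integral integrates every derivative; this covers
    \<open>\<phi>'\<close>, which may be irregular in time through \<open>G\<close>.\<close>
  have ftc: "(\<phi>' has_integral (\<phi> p - \<phi> q)) {q..p}"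
    if "q \<le> p" "\<forall>s\<le>p. (\<phi> has_vector_derivative \<phi>' s) (at s within {..p})" for \<phi> \<phi>' :: "real \<Rightarrow> real" and q
    using that by (intro fundamental_theorem_of_calculus) (auto intro: has_vector_derivative_within_subset)
  have int: "?h integrable_on {q..p}" if q: "q \<le> p" for q
  proof -
    have "?h integrable_on cbox q p"
    proof (rule integrable_uniform_limit)
      fix \<eta> :: real assume \<eta>: "\<eta> > 0"
      \<comment> \<open>\<open>\<epsilon> * Q\<close> dominates the distance of
        \<open>\<phi>' / \<epsilon>\<close> from \<open>?h\<close> on the interval; the summand 1
        makes \<open>Q\<close> positive.\<close>
      define Q where "Q = C1 * exp (c * p) * D + 1"
      have Q: "Q > 0" unfolding Q_def using C1(1) D by (intro add_nonneg_pos) auto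
      define \<epsilon> where "\<epsilon> = min e1 (\<eta> / Q)"
      have \<epsilon>: "0 < \<epsilon>" "\<epsilon> \<le> e1" "\<epsilon> * Q \<le> \<eta>"
        unfolding \<epsilon>_def using e1 \<eta> Q by (auto simp: field_simps min_def)
      obtain \<phi> \<phi>' where *: "\<forall>s\<le>p. (\<phi> has_vector_derivative \<phi>' s) (at s within {..p})"
        "\<And>s. s \<le> p \<Longrightarrow> \<bar>\<phi>' s - \<epsilon> * ?h s\<bar> \<le> C1 * exp (c * s) * (D * \<epsilon>\<^sup>2)"
        using key[OF \<epsilon>(1,2)] by blast
      show "\<exists>g. (\<forall>x\<in>cbox q p. norm (?h x - g x) \<le> \<eta>) \<and> g integrable_on cbox q p"
      proof (intro exI[of _ "\<lambda>s. \<phi>' s / \<epsilon>"] conjI ballI)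
        show "(\<lambda>s. \<phi>' s / \<epsilon>) integrable_on cbox q p"
          using ftc[OF q *(1)] by (auto intro!: integrable_on_divide)
        fix s assume "s \<in> cbox q p"
        then have s: "s \<le> p" by simp
        have "\<bar>\<phi>' s - \<epsilon> * ?h s\<bar> \<le> C1 * exp (c * s) * (D * \<epsilon>\<^sup>2)" by (rule *(2)[OF s])
        also have "\<dots> \<le> C1 * exp (c * p) * (D * \<epsilon>\<^sup>2)"
          using s C1(1) D decay(1) by (intro mult_right_mono mult_left_mono) auto
        also have "\<dots> = \<epsilon> * (\<epsilon> * (C1 * exp (c * p) * D))" by (simp add: power2_eq_square)
        also have "\<dots> \<le> \<epsilon> * \<eta>"
          using \<epsilon> unfolding Q_def by (intro mult_left_mono) (auto simp: algebra_simps)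
        finally have "\<bar>\<phi>' s - \<epsilon> * ?h s\<bar> \<le> \<epsilon> * \<eta>" .
        moreover have "\<phi>' s - \<epsilon> * ?h s = \<epsilon> * (\<phi>' s / \<epsilon> - ?h s)" using \<epsilon> by (simp add: field_simps)
        ultimately have "\<epsilon> * \<bar>\<phi>' s / \<epsilon> - ?h s\<bar> \<le> \<epsilon> * \<eta>" using \<epsilon>(1) by (simp add: abs_mult)
        then show "norm (?h s - \<phi>' s / \<epsilon>) \<le> \<eta>" using \<epsilon>(1) by (simp add: abs_minus_commute)
      qed
    qed
    then show ?thesis by simp
  qed
  have h_le: "\<bar>?h s\<bar> \<le> (C1 * B) * exp (c * s)" if "s \<le> p" for s
  proof -
    have "\<bar>?h s\<bar> \<le> norm (V s) * norm (G (X s) s)" by (rule Cauchy_Schwarz_ineq2)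
    also have "\<dots> \<le> (C1 * exp (c * s)) * B"
      using C1 that G_le[OF X(2)] by (intro mult_mono) auto
    finally show ?thesis by (simp add: algebra_simps)
  qed
  note half = integrable_on_halfline_exp_bound[where h="?h" and p=p, OF decay(1) int h_le]
  show "?h integrable_on {..p}" by (rule half(1))
  let ?J = "integral {..p} ?h"
  define W where "W = C1 * (exp (c * p) / c)"
  have "\<bar>V p \<bullet> (Z \<epsilon> - X p) - \<epsilon> * ?J\<bar> \<le> (W * D) * \<epsilon>\<^sup>2" if \<epsilon>: "0 < \<epsilon>" "\<epsilon> \<le> e1" for \<epsilon>
  proof -
    obtain \<phi> \<phi>' where \<phi>p: "\<phi> p = V p \<bullet> (Z \<epsilon> - X p)"
      and d: "\<forall>s\<le>p. (\<phi> has_vector_derivative \<phi>' s) (at s within {..p})"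
      and \<phi>_le: "\<And>s. s \<le> p \<Longrightarrow> \<bar>\<phi> s\<bar> \<le> C1 * exp (c * s) * (\<bar>K\<bar> * \<epsilon>)"
      and \<phi>'_le: "\<And>s. s \<le> p \<Longrightarrow> \<bar>\<phi>' s - \<epsilon> * ?h s\<bar> \<le> C1 * exp (c * s) * (D * \<epsilon>\<^sup>2)"
      using key[OF \<epsilon>] by blast
    \<comment> \<open>Truncation at \<open>q\<close>: the boundary term \<open>\<phi> q\<close> and
      the tail of the integral both carry the factor \<open>exp (c * q)\<close>, which disappears as
      \<open>q\<close> tends to minus infinity.\<close>
    have est: "\<bar>\<phi> p - \<epsilon> * ?J\<bar> \<le> W * D * \<epsilon>\<^sup>2 + (C1 * (\<bar>K\<bar> * \<epsilon>) + \<epsilon> * (C1 * B / c)) * exp (c * q)"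
      if q: "q \<le> p" for q
    proof -
      have I1: "((\<lambda>s. \<phi>' s - \<epsilon> * ?h s) has_integral (\<phi> p - \<phi> q - \<epsilon> * integral {q..p} ?h)) {q..p}"
        using int[OF q] by (intro has_integral_diff ftc q d has_integral_mult_right) auto
      have I2: "((\<lambda>s. C1 * exp (c * s) * (D * \<epsilon>\<^sup>2)) has_integral W * (D * \<epsilon>\<^sup>2)) {..p}"
        unfolding W_def
        by (intro has_integral_mult_left has_integral_mult_right has_integral_exp_from_minus_infinity decay(1))
      have I3: "(\<lambda>s. C1 * exp (c * s) * (D * \<epsilon>\<^sup>2)) integrable_on {q..p}"
        by (intro integrable_continuous_interval continuous_intros)
      have "\<bar>\<phi> p - \<phi> q - \<epsilon> * integral {q..p} ?h\<bar> \<le> integral {q..p} (\<lambda>s. C1 * exp (c * s) * (D * \<epsilon>\<^sup>2))"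
        using integral_norm_bound_integral[OF has_integral_integrable[OF I1] I3] \<phi>'_le
        by (simp add: integral_unique[OF I1])
      also have "\<dots> \<le> integral {..p} (\<lambda>s. C1 * exp (c * s) * (D * \<epsilon>\<^sup>2))"
        using I2 I3 C1(1) D by (intro integral_subset_le) auto
      also have "\<dots> = W * D * \<epsilon>\<^sup>2" using integral_unique[OF I2] by (simp only: mult.assoc)
      finally have A: "\<bar>\<phi> p - \<phi> q - \<epsilon> * integral {q..p} ?h\<bar> \<le> W * D * \<epsilon>\<^sup>2" .
      have "\<bar>\<epsilon> * (?J - integral {q..p} ?h)\<bar> \<le> \<epsilon> * (C1 * B * exp (c * q) / c)"
        using mult_left_mono[OF half(2)[OF _ _ q], of \<epsilon>] \<epsilon>(1) by (simp add: abs_mult)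
      then have B: "\<bar>\<epsilon> * ?J - \<epsilon> * integral {q..p} ?h\<bar> \<le> \<epsilon> * (C1 * B / c) * exp (c * q)"
        by (simp add: algebra_simps)
      have C: "\<bar>\<phi> q\<bar> \<le> C1 * (\<bar>K\<bar> * \<epsilon>) * exp (c * q)" using \<phi>_le[OF q] by (simp add: algebra_simps)
      show ?thesis using A B C by (simp add: distrib_right)
    qed
    have "((\<lambda>q. exp (c * q)) \<longlongrightarrow> 0) at_bot"
      by (intro filterlim_compose[OF exp_at_bot] filterlim_tendsto_pos_mult_at_bot[OF tendsto_const decay(1)] filterlim_ident)
    then have "((\<lambda>q. W * D * \<epsilon>\<^sup>2 + (C1 * (\<bar>K\<bar> * \<epsilon>) + \<epsilon> * (C1 * B / c)) * exp (c * q)) \<longlongrightarrow> 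
        W * D * \<epsilon>\<^sup>2 + (C1 * (\<bar>K\<bar> * \<epsilon>) + \<epsilon> * (C1 * B / c)) * 0) at_bot"
      by (intro tendsto_intros)
    moreover have "\<forall>\<^sub>F q in at_bot. \<bar>\<phi> p - \<epsilon> * ?J\<bar> \<le>
        W * D * \<epsilon>\<^sup>2 + (C1 * (\<bar>K\<bar> * \<epsilon>) + \<epsilon> * (C1 * B / c)) * exp (c * q)"
      by (rule eventually_mono[OF eventually_le_at_bot[of p]]) (rule est)
    ultimately have "\<bar>\<phi> p - \<epsilon> * ?J\<bar> \<le>
        W * D * \<epsilon>\<^sup>2 + (C1 * (\<bar>K\<bar> * \<epsilon>) + \<epsilon> * (C1 * B / c)) * 0"
      by (rule tendsto_lowerbound) simp
    then show ?thesis by (simp add: \<phi>p)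
  qed
  then show "\<exists>D. \<forall>\<^sub>F \<epsilon> in at_right 0. \<bar>V p \<bullet> (Z \<epsilon> - X p) - \<epsilon> * ?J\<bar> \<le> D * \<epsilon>\<^sup>2"
    using e1 by (intro exI[of _ "W * D"]) (auto simp: eventually_at_right_field intro!: exI[of _ e1])
qed

text \<open>A general orbit family, forcing \<open>G\<close> and scalar weight \<open>e\<close> let
  this serve both ends: time reversal changes the signs of \<open>f\<close> and \<open>G\<close>,
  and the sign of the cross product goes into \<open>e\<close>.\<close>

lemma one_sided_melnikov_expansion:
  fixes f :: "real^3 \<Rightarrow> real^3" and f' :: "real^3 \<Rightarrow> ((real^3) \<Rightarrow>\<^sub>L (real^3))"
    and f'' :: "real^3 \<Rightarrow> ((real^3) \<Rightarrow>\<^sub>L ((real^3) \<Rightarrow>\<^sub>L (real^3)))"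
    and G :: "real^3 \<Rightarrow> real \<Rightarrow> real^3" and G' :: "real \<Rightarrow> real^3 \<Rightarrow> real^3 \<Rightarrow> real^3"
    and X Xa :: "real \<Rightarrow> real \<Rightarrow> real^3" and V V' :: "real \<Rightarrow> real^3"
  assumes \<Omega>: "open \<Omega>" "a \<in> \<Omega>"
    and f': "\<And>x. x \<in> \<Omega> \<Longrightarrow> (f has_derivative f' x) (at x)"
    and f'': "\<And>x. x \<in> \<Omega> \<Longrightarrow> (f' has_derivative f'' x) (at x)" and cont: "continuous_on \<Omega> f''"
    and spec: "one_neg_two_pos_spectrum (jacobian f (at a))"
    and surf: "C2_surface \<Gamma>" "compact \<Gamma>"
    and X\<Omega>: "\<And>s \<alpha>. X s \<alpha> \<in> \<Omega>" and per: "\<And>s \<alpha>. X s (\<alpha> + 1) = X s \<alpha>"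
    and bij: "bij_betw (\<lambda>(s, \<alpha>). X s \<alpha>) (UNIV \<times> {0..<1}) (\<Gamma> - {a, b})"
    and flow: "\<And>s \<alpha>. ((\<lambda>s. X s \<alpha>) has_vector_derivative f (X s \<alpha>)) (at s)"
    and lim: "\<And>\<alpha>. ((\<lambda>s. X s \<alpha>) \<longlongrightarrow> a) at_bot" and ab: "a \<noteq> b"
    and X': "\<And>s \<alpha>. ((\<lambda>(s, \<alpha>). X s \<alpha>) has_derivative (\<lambda>(u, v). u *\<^sub>R f (X s \<alpha>) + v *\<^sub>R Xa s \<alpha>)) (at (s, \<alpha>))"
    and V: "\<And>s. (V has_vector_derivative V' s) (at s)" "\<And>s w. V' s \<bullet> w = - (V s \<bullet> f' (X s \<alpha>) w)"
    and V_eq: "\<And>s. V s = e s *\<^sub>R cross3 (f (X s \<alpha>)) (Xa s \<alpha>)" and V_nz: "\<And>s. V s \<noteq> 0"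
    and G': "\<And>s x. x \<in> \<Omega> \<Longrightarrow> ((\<lambda>x. G x s) has_derivative G' s x) (at x)"
    and G'_le: "\<And>s x. x \<in> \<Omega> \<Longrightarrow> onorm (G' s x) \<le> L" and G_le: "\<And>s x. x \<in> \<Omega> \<Longrightarrow> norm (G x s) \<le> B"
    and \<epsilon>0: "0 < \<epsilon>0"
    and Y: "\<And>\<epsilon>. 0 \<le> \<epsilon> \<Longrightarrow> \<epsilon> \<le> \<epsilon>0 \<Longrightarrow> \<exists>Y. Y p = Z \<epsilon> \<and>
        (\<forall>s\<le>p. Y s \<in> \<Omega> \<and> (Y has_vector_derivative f (Y s) + \<epsilon> *\<^sub>R G (Y s) s) (at s within {..p})
                \<and> norm (Y s - X s \<alpha>) \<le> K * \<epsilon>)"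
  shows "(\<lambda>s. V s \<bullet> G (X s \<alpha>) s) integrable_on {..p}"
    and "\<exists>D. \<forall>\<^sub>F \<epsilon> in at_right 0.
      \<bar>V p \<bullet> (Z \<epsilon> - X p \<alpha>) - \<epsilon> * integral {..p} (\<lambda>s. V s \<bullet> G (X s \<alpha>) s)\<bar> \<le> D * \<epsilon>\<^sup>2"
proof -
  have contX: "continuous_on UNIV (\<lambda>(s, \<alpha>). X s \<alpha>)"
  proof (intro continuous_at_imp_continuous_on ballI)
    fix z :: "real \<times> real"
    show "isCont (\<lambda>(s, \<alpha>). X s \<alpha>) z"
      using has_derivative_continuous[OF X'[of "fst z" "snd z"]] by simp
  qed
  have contf': "continuous_on \<Omega> f'"
    by (intro continuous_at_imp_continuous_on ballI has_derivative_continuous[OF f''])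
  have unif: "\<exists>T. \<forall>s\<le>T. \<forall>\<alpha>. dist (X s \<alpha>) a < \<delta>" if "\<delta> > 0" for \<delta>
    by (rule cylinder_uniform_limit[OF surf contX per bij lim ab that]) blast
  obtain c T C where c: "c > 0" and "\<forall>s\<le>T. norm (V s) \<le> C * exp (c * s)"
    by (rule adjoint_backward_decay[OF \<Omega> f' contf' has_derivative_jacobian_eq[OF f'[OF \<Omega>(2)]] spec
          flow unif X' V V_eq V_nz]) blast
  then have decay: "norm (V s) \<le> C * exp (c * s)" if "s \<le> T" for s using that by blast
  note H = decaying_adjoint_pairing[OF \<Omega> f' f'' cont G' G'_le G_le flow X\<Omega> lim V c decay \<epsilon>0 Y]
  show "(\<lambda>s. V s \<bullet> G (X s \<alpha>) s) integrable_on {..p}"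
    "\<exists>D. \<forall>\<^sub>F \<epsilon> in at_right 0.
      \<bar>V p \<bullet> (Z \<epsilon> - X p \<alpha>) - \<epsilon> * integral {..p} (\<lambda>s. V s \<bullet> G (X s \<alpha>) s)\<bar> \<le> D * \<epsilon>\<^sup>2"
    using H by blast+
qed

subsection \<open>Time reversal and the distance of the manifolds\<close>

lemma one_neg_two_pos_spectrum_uminus:
  assumes "one_pos_two_neg_spectrum A"
  shows "one_neg_two_pos_spectrum (- A)"
proof -
  have "eigenvector (map_matrix complex_of_real (- A)) v (- k)"
    if "eigenvector (map_matrix complex_of_real A) v k" for v k
  proof -
    have "map_matrix complex_of_real (- A) *v v = - (map_matrix complex_of_real A *v v)"
      by (simp add: matrix_vector_mult_def map_matrix_def vec_eq_iff sum_negf)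
    then show ?thesis using that by (simp add: eigenvector_def vec_eq_iff)
  qed
  note ev = this
  obtain k1 k2 k3 v1 v2 v3 where k: "k1 > 0" "Re k2 < 0" "Re k3 < 0"
    and v: "eigenvector (map_matrix complex_of_real A) v1 (complex_of_real k1)"
      "eigenvector (map_matrix complex_of_real A) v2 k2" "eigenvector (map_matrix complex_of_real A) v3 k3"
      "v2 \<noteq> v3" "vec.independent {v2, v3}"
    using assms unfolding one_pos_two_neg_spectrum_def by blast
  show ?thesis
    unfolding one_neg_two_pos_spectrum_def
    by (rule exI[of _ "- k1"], rule exI[of _ "- k2"], rule exI[of _ "- k3"],
        rule exI[of _ v1], rule exI[of _ v2], rule exI[of _ v3])
      (use k v ev[OF v(1)] ev[OF v(2)] ev[OF v(3)] in simp)
qed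

lemma jacobian_uminus:
  fixes f :: "real^'n \<Rightarrow> real^'m"
  assumes "(f has_derivative f') (at x)"
  shows "jacobian (\<lambda>x. - f x) (at x) = - jacobian f (at x)"
proof -
  have "jacobian (\<lambda>x. - f x) (at x) *v v = - jacobian f (at x) *v v" for v
    using has_derivative_jacobian_eq[OF assms, of v]
      has_derivative_jacobian_eq[OF has_derivative_minus[OF assms], of v]
    by (simp add: matrix_vector_mult_def vec_eq_iff sum_negf)
  then show ?thesis by (simp add: matrix_eq)
qed

text \<open>The spatial derivative of \<open>g\<close> is bounded in the Euclidean norm of matrices,
  while the mean value inequality uses the operator norm.\<close>

lemma onorm_matrix_le:
  "\<exists>K. \<forall>A :: real^'n^'m. onorm ((*v) A) \<le> norm A * K"
proof -
  have "bilinear ((*v) :: real^'n^'m \<Rightarrow> real^'n \<Rightarrow> real^'m)"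
    unfolding bilinear_def
    by (auto intro!: linearI simp: matrix_vector_mult_add_rdistrib scaleR_matrix_vector_assoc)
  then have "bounded_bilinear ((*v) :: real^'n^'m \<Rightarrow> real^'n \<Rightarrow> real^'m)"
    by (simp add: bilinear_conv_bounded_bilinear)
  then obtain K where K: "\<And>(A :: real^'n^'m) x. norm (A *v x) \<le> norm A * norm x * K"
    using bounded_bilinear.bounded by blast
  have "onorm ((*v) A) \<le> norm A * K" for A :: "real^'n^'m"
    using K[of A] by (intro onorm_le) (simp add: mult_ac)
  then show ?thesis by blast
qed

text \<open>The image condition on \<open>\<phi>\<close> carries along the one-sided derivatives at
  the end point of a half-line, where the perturbed solutions stop.\<close>

lemma has_vector_derivative_reparametrized:
  fixes y :: "real \<Rightarrow> 'a::real_normed_vector"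
  assumes "(\<phi> has_real_derivative c) (at s within S)" "\<phi> ` S \<subseteq> T"
    and "(y has_vector_derivative y') (at (\<phi> s) within T)"
  shows "((\<lambda>s. y (\<phi> s)) has_vector_derivative c *\<^sub>R y') (at s within S)"
proof -
  have "(y has_vector_derivative y') (at (\<phi> s) within \<phi> ` S)"
    by (rule has_vector_derivative_within_subset[OF assms(3,2)])
  from vector_diff_chain_within[OF assms(1)[unfolded has_real_derivative_iff_has_vector_derivative] this]
  show ?thesis by (simp add: o_def)
qed

lemma has_vector_derivative_reflect:
  fixes y :: "real \<Rightarrow> 'a::real_normed_vector"
  assumes "(y has_vector_derivative y') (at (- s))"
  shows "((\<lambda>s. y (- s)) has_vector_derivative - y') (at s)"
proof -
  have "((\<lambda>s. - s) has_real_derivative - 1) (at s)" by (rule DERIV_minus[OF DERIV_ident])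
  from has_vector_derivative_reparametrized[OF this subset_UNIV assms] show ?thesis by simp
qed

text \<open>The order symbol is taken at each fixed (p, \<alpha>, t), in keeping with closeness
  constants that may depend on these.\<close>

theorem theorem3:
  fixes \<Omega> :: "(real^3) set"
    and f :: "real^3 \<Rightarrow> real^3" and g :: "real^3 \<Rightarrow> real \<Rightarrow> real^3"
    and a b :: "real^3" and \<Gamma> :: "(real^3) set"
    and xbar :: "real \<Rightarrow> real \<Rightarrow> real^3"
    and a\<epsilon> b\<epsilon> :: "real \<Rightarrow> real \<Rightarrow> real^3"
    and xu xs :: "real \<Rightarrow> real \<Rightarrow> real \<Rightarrow> real \<Rightarrow> real^3"
    and Ps Pu Ts Tu :: real
  assumes "open \<Omega>"
    and f_C2: "C2_on f \<Omega>"
    and Df_bounded: "bounded ((\<lambda>x. jacobian f (at x)) ` \<Omega>)"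
    and g_C2: "\<And>t. C2_on (\<lambda>x. g x t) \<Omega>"
    and g_bounded: "bounded ((\<lambda>(x, t). g x t) ` (\<Omega> \<times> UNIV))"
    and Dg_bounded: "bounded ((\<lambda>(x, t). jacobian (\<lambda>y. g y t) (at x)) ` (\<Omega> \<times> UNIV))"
    and fixed_points: "a \<in> \<Omega>" "b \<in> \<Omega>" "a \<noteq> b" "f a = 0" "f b = 0"
    and spectrum_a: "one_neg_two_pos_spectrum (jacobian f (at a))"
    and spectrum_b: "one_pos_two_neg_spectrum (jacobian f (at b))"
    and manifolds_C2: "C2_surface (unstable_manifold f \<Omega> a)" "C2_surface (stable_manifold f \<Omega> b)"
    and \<Gamma>_unstable: "\<Gamma> = insert b (unstable_manifold f \<Omega> a)"
    and \<Gamma>_stable: "\<Gamma> = insert a (stable_manifold f \<Omega> b)"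
    and \<Gamma>_surface: "closed_surface \<Gamma>" "orientable_surface \<Gamma>" "inside \<Gamma> \<noteq> {}"
    and xbar_C2: "C2_on (\<lambda>(p, \<alpha>). xbar p \<alpha>) UNIV"
    and xbar_periodic: "\<And>p \<alpha>. xbar p (\<alpha> + 1) = xbar p \<alpha>"
    and xbar_bij: "bij_betw (\<lambda>(p, \<alpha>). xbar p \<alpha>) (UNIV \<times> {0..<1}) (\<Gamma> - {a, b})"
    and xbar_flow: "\<And>p \<alpha>. ((\<lambda>q. xbar q \<alpha>) has_vector_derivative f (xbar p \<alpha>)) (at p)"
    and xbar_a: "\<And>\<alpha>. ((\<lambda>p. xbar p \<alpha>) \<longlongrightarrow> a) at_bot"
    and xbar_b: "\<And>\<alpha>. ((\<lambda>p. xbar p \<alpha>) \<longlongrightarrow> b) at_top"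
    and normal_nonzero: "\<And>p \<alpha>. surface_normal f xbar p \<alpha> \<noteq> 0"
    and normal_outward: "\<And>p \<alpha>. points_outward \<Gamma> (xbar p \<alpha>) (surface_normal f xbar p \<alpha>)"
    and a\<epsilon>_hyperbolic: "\<exists>\<epsilon>\<^sub>1>0. \<exists>C. \<forall>\<epsilon>\<in>{0..\<epsilon>\<^sub>1}.
          hyperbolic_trajectory (perturbed f g \<epsilon>) \<Omega> (a\<epsilon> \<epsilon>) \<and> (\<forall>t. norm (a\<epsilon> \<epsilon> t - a) \<le> C * \<epsilon>)"
    and b\<epsilon>_hyperbolic: "\<exists>\<epsilon>\<^sub>1>0. \<exists>C. \<forall>\<epsilon>\<in>{0..\<epsilon>\<^sub>1}.
          hyperbolic_trajectory (perturbed f g \<epsilon>) \<Omega> (b\<epsilon> \<epsilon>) \<and> (\<forall>t. norm (b\<epsilon> \<epsilon> t - b) \<le> C * \<epsilon>)"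
    and xu_close: "\<And>p \<alpha> t. p \<le> Pu \<Longrightarrow> \<alpha> \<in> {0..<1} \<Longrightarrow> t \<le> Tu \<Longrightarrow>
          \<exists>\<epsilon>\<^sub>0>0. \<exists>K. \<forall>\<epsilon>\<in>{0..\<epsilon>\<^sub>0}. \<exists>y.
            solves (perturbed f g \<epsilon>) \<Omega> {..t} y \<and> y t = xu p \<alpha> \<epsilon> t \<and>
            (\<forall>\<tau>\<le>t. y \<tau> \<in> unstable_slice (perturbed f g \<epsilon>) \<Omega> (a\<epsilon> \<epsilon>) \<tau> \<and>
                    norm (y \<tau> - xbar (\<tau> - t + p) \<alpha>) \<le> K * \<epsilon>)"
    and xs_close: "\<And>p \<alpha> t. Ps \<le> p \<Longrightarrow> \<alpha> \<in> {0..<1} \<Longrightarrow> Ts \<le> t \<Longrightarrow>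
          \<exists>\<epsilon>\<^sub>0>0. \<exists>K. \<forall>\<epsilon>\<in>{0..\<epsilon>\<^sub>0}. \<exists>y.
            solves (perturbed f g \<epsilon>) \<Omega> {t..} y \<and> y t = xs p \<alpha> \<epsilon> t \<and>
            (\<forall>\<tau>\<ge>t. y \<tau> \<in> stable_slice (perturbed f g \<epsilon>) \<Omega> (b\<epsilon> \<epsilon>) \<tau> \<and>
                    norm (y \<tau> - xbar (\<tau> - t + p) \<alpha>) \<le> K * \<epsilon>)"
  shows "\<forall>p\<in>{Ps..Pu}. \<forall>\<alpha>\<in>{0..<1}. \<forall>t\<in>{Ts..Tu}.
           melnikov_integrand f g xbar p \<alpha> t integrable_on UNIV \<and>
           (\<lambda>\<epsilon>. normal_distance f xbar xu xs p \<alpha> \<epsilon> t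
                 - \<epsilon> * (melnikov f g xbar p \<alpha> t / norm (surface_normal f xbar p \<alpha>)))
             \<in> O[at_right 0](\<lambda>\<epsilon>. \<epsilon>\<^sup>2)"
proof (intro ballI)
  fix p \<alpha> t :: real assume p: "p \<in> {Ps..Pu}" and \<alpha>: "\<alpha> \<in> {0..<1}" and t: "t \<in> {Ts..Tu}"

  \<comment> \<open>Regularity data and the adjoint solution along the chosen orbit\<close>
  obtain f' f'' where "\<forall>x\<in>\<Omega>. (f has_derivative blinfun_apply (f' x)) (at x)"
    "\<forall>x\<in>\<Omega>. (f' has_derivative blinfun_apply (f'' x)) (at x)" and cont: "continuous_on \<Omega> f''"
    using f_C2 unfolding C2_on_def by auto
  then have f': "\<And>x. x \<in> \<Omega> \<Longrightarrow> (f has_derivative f' x) (at x)"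
    and f'': "\<And>x. x \<in> \<Omega> \<Longrightarrow> (f' has_derivative f'' x) (at x)" by blast+
  have contf': "continuous_on \<Omega> f'"
    by (intro continuous_at_imp_continuous_on ballI has_derivative_continuous[OF f''])
  have g': "((\<lambda>x. g x s) has_derivative (\<lambda>v. jacobian (\<lambda>y. g y s) (at x) *v v)) (at x)" if "x \<in> \<Omega>" for x s
    using g_C2[of s] that unfolding C2_on_def jacobian_works[symmetric] differentiable_def by blast
  obtain B where B: "\<And>x s. x \<in> \<Omega> \<Longrightarrow> norm (g x s) \<le> B"
    using g_bounded unfolding bounded_iff by fastforce
  obtain L where L: "\<And>x s. x \<in> \<Omega> \<Longrightarrow> onorm ((*v) (jacobian (\<lambda>y. g y s) (at x))) \<le> L"
  proof -
    obtain L0 where L0: "\<And>x s. x \<in> \<Omega> \<Longrightarrow> norm (jacobian (\<lambda>y. g y s) (at x)) \<le> L0"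
      using Dg_bounded unfolding bounded_iff by fastforce
    obtain K where K: "\<And>A :: real^3^3. onorm ((*v) A) \<le> norm A * K"
      using onorm_matrix_le by blast
    have "onorm ((*v) (jacobian (\<lambda>y. g y s) (at x))) \<le> L0 * \<bar>K\<bar>" if "x \<in> \<Omega>" for x s
    proof -
      have "onorm ((*v) (jacobian (\<lambda>y. g y s) (at x))) \<le> norm (jacobian (\<lambda>y. g y s) (at x)) * K"
        by (rule K)
      also have "\<dots> \<le> norm (jacobian (\<lambda>y. g y s) (at x)) * \<bar>K\<bar>" by (intro mult_left_mono) auto
      also have "\<dots> \<le> L0 * \<bar>K\<bar>" by (intro mult_right_mono L0 that) auto
      finally show ?thesis .
    qed
    then show ?thesis by (rule that)
  qed
  have "unstable_manifold f \<Omega> a \<subseteq> \<Omega>"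
    unfolding unstable_manifold_def unstable_slice_def solves_def by auto
  then have X\<Omega>: "xbar s \<beta> \<in> \<Omega>" for s \<beta>
    using cylinder_image_range[OF xbar_periodic xbar_bij, of s \<beta>] \<Gamma>_unstable by blast
  have surf: "C2_surface \<Gamma>" "compact \<Gamma>" using \<Gamma>_surface(1) unfolding closed_surface_def by auto
  obtain Xa where
    "\<forall>s \<alpha>. ((\<lambda>(s, \<alpha>). xbar s \<alpha>) has_derivative (\<lambda>(u, v). u *\<^sub>R f (xbar s \<alpha>) + v *\<^sub>R Xa s \<alpha>)) (at (s, \<alpha>))"
    "\<forall>s \<alpha>. (xbar s has_vector_derivative Xa s \<alpha>) (at \<alpha>)"
    "\<forall>s \<alpha>. ((\<lambda>s. Xa s \<alpha>) has_vector_derivative f' (xbar s \<alpha>) (Xa s \<alpha>)) (at s)"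
    by (rule flow_parameter_derivative[OF \<open>open \<Omega>\<close> X\<Omega> f' contf' xbar_flow xbar_C2])
  then have
    X': "\<And>s \<alpha>. ((\<lambda>(s, \<alpha>). xbar s \<alpha>) has_derivative (\<lambda>(u, v). u *\<^sub>R f (xbar s \<alpha>) + v *\<^sub>R Xa s \<alpha>)) (at (s, \<alpha>))"
    and Xa: "\<And>s \<alpha>. (xbar s has_vector_derivative Xa s \<alpha>) (at \<alpha>)"
    and Xa': "\<And>s \<alpha>. ((\<lambda>s. Xa s \<alpha>) has_vector_derivative f' (xbar s \<alpha>) (Xa s \<alpha>)) (at s)"
    by blast+
  have normal: "surface_normal f xbar s \<beta> = cross3 (f (xbar s \<beta>)) (Xa s \<beta>)" for s \<beta>
    unfolding surface_normal_def using vector_derivative_at[OF Xa] by simp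
  define E where "E s = exp (LBINT \<xi>=ereal s..ereal p. divergence f (xbar \<xi> \<alpha>))" for s :: real
  define V where "V s = E s *\<^sub>R cross3 (f (xbar s \<alpha>)) (Xa s \<alpha>)" for s
  obtain V' where V: "\<And>s. (V has_vector_derivative V' s) (at s)"
    "\<And>s w. V' s \<bullet> w = - (V s \<bullet> f' (xbar s \<alpha>) w)"
    using weighted_normal_adjoint[of "\<lambda>s. xbar s \<alpha>" \<Omega> f f' "\<lambda>s. Xa s \<alpha>" p, OF X\<Omega> f' contf' xbar_flow Xa']
    unfolding V_def[abs_def] E_def by blast
  have V_nz: "V s \<noteq> 0" for s
    using normal_nonzero[of s \<alpha>] unfolding V_def E_def normal by simp
  have Vp: "V p = surface_normal f xbar p \<alpha>" unfolding V_def E_def normal by simp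
  \<comment> \<open>Time is shifted so that the orbit parameter \<open>s = p\<close> corresponds to
    the instant \<open>t\<close>.\<close>
  define G where "G x s = g x (s + t - p)" for x s
  define h where "h s = V s \<bullet> G (xbar s \<alpha>) s" for s
  have h: "melnikov_integrand f g xbar p \<alpha> t = h"
    by (rule ext) (simp add: melnikov_integrand_def h_def V_def E_def G_def normal)

  \<comment> \<open>Expansion on the unstable side\<close>
  obtain \<epsilon>u Ku where \<epsilon>u: "\<epsilon>u > 0" and yu: "\<forall>\<epsilon>\<in>{0..\<epsilon>u}. \<exists>y.
      solves (perturbed f g \<epsilon>) \<Omega> {..t} y \<and> y t = xu p \<alpha> \<epsilon> t \<and>
      (\<forall>\<tau>\<le>t. y \<tau> \<in> unstable_slice (perturbed f g \<epsilon>) \<Omega> (a\<epsilon> \<epsilon>) \<tau> \<and>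
        norm (y \<tau> - xbar (\<tau> - t + p) \<alpha>) \<le> Ku * \<epsilon>)"
    using xu_close[of p \<alpha> t] p \<alpha> t by auto
  have Yu: "\<exists>Y. Y p = xu p \<alpha> \<epsilon> t \<and> (\<forall>s\<le>p. Y s \<in> \<Omega> \<and>
      (Y has_vector_derivative f (Y s) + \<epsilon> *\<^sub>R G (Y s) s) (at s within {..p}) \<and>
      norm (Y s - xbar s \<alpha>) \<le> Ku * \<epsilon>)" if \<epsilon>: "0 \<le> \<epsilon>" "\<epsilon> \<le> \<epsilon>u" for \<epsilon>
  proof -
    obtain y where y: "solves (perturbed f g \<epsilon>) \<Omega> {..t} y" "y t = xu p \<alpha> \<epsilon> t"
      "\<And>\<tau>. \<tau> \<le> t \<Longrightarrow> norm (y \<tau> - xbar (\<tau> - t + p) \<alpha>) \<le> Ku * \<epsilon>"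
      using yu \<epsilon> by force
    have "((\<lambda>s. y (s + t - p)) has_vector_derivative
        1 *\<^sub>R (f (y (s + t - p)) + \<epsilon> *\<^sub>R G (y (s + t - p)) s)) (at s within {..p})" if "s \<le> p" for s
    proof (rule has_vector_derivative_reparametrized)
      show "((\<lambda>s. s + t - p) has_real_derivative 1) (at s within {..p})"
        by (auto intro!: derivative_eq_intros)
      show "(y has_vector_derivative f (y (s + t - p)) + \<epsilon> *\<^sub>R G (y (s + t - p)) s) (at (s + t - p) within {..t})"
        using y(1) that unfolding solves_def perturbed_def G_def by auto
    qed auto
    moreover have "norm (y (s + t - p) - xbar s \<alpha>) \<le> Ku * \<epsilon>" "y (s + t - p) \<in> \<Omega>" if "s \<le> p" for s
      using y(3)[of "s + t - p"] y(1) that by (simp_all add: solves_def)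
    ultimately show ?thesis
      using y(2) by (intro exI[of _ "\<lambda>s. y (s + t - p)"]) simp
  qed
  have G': "((\<lambda>x. G x s) has_derivative (\<lambda>v. jacobian (\<lambda>y. g y (s + t - p)) (at x) *v v)) (at x)"
    and GL: "onorm (\<lambda>v. jacobian (\<lambda>y. g y (s + t - p)) (at x) *v v) \<le> L"
    and GB: "norm (G x s) \<le> B" if "x \<in> \<Omega>" for x s
    unfolding G_def by (intro g' L B that)+
  note unstable = one_sided_melnikov_expansion[where X=xbar and Xa=Xa and V=V and V'=V' and e=E and G=G
      and p=p and f=f and f'=f' and f''=f'',
      OF \<open>open \<Omega>\<close> fixed_points(1) f' f'' cont spectrum_a surf X\<Omega>
      xbar_periodic xbar_bij xbar_flow xbar_a fixed_points(3) X' V V_def V_nz G' GL GB \<epsilon>u Yu, folded h_def]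

  \<comment> \<open>Expansion on the stable side\<close>
  obtain \<epsilon>s Ks where \<epsilon>s: "\<epsilon>s > 0" and ys: "\<forall>\<epsilon>\<in>{0..\<epsilon>s}. \<exists>y.
      solves (perturbed f g \<epsilon>) \<Omega> {t..} y \<and> y t = xs p \<alpha> \<epsilon> t \<and>
      (\<forall>\<tau>\<ge>t. y \<tau> \<in> stable_slice (perturbed f g \<epsilon>) \<Omega> (b\<epsilon> \<epsilon>) \<tau> \<and>
        norm (y \<tau> - xbar (\<tau> - t + p) \<alpha>) \<le> Ks * \<epsilon>)"
    using xs_close[of p \<alpha> t] p \<alpha> t by auto
  have Ys: "\<exists>Y. Y (- p) = xs p \<alpha> \<epsilon> t \<and> (\<forall>s\<le>- p. Y s \<in> \<Omega> \<and>
      (Y has_vector_derivative - f (Y s) + \<epsilon> *\<^sub>R (- G (Y s) (- s))) (at s within {..- p}) \<and>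
      norm (Y s - xbar (- s) \<alpha>) \<le> Ks * \<epsilon>)" if \<epsilon>: "0 \<le> \<epsilon>" "\<epsilon> \<le> \<epsilon>s" for \<epsilon>
  proof -
    obtain y where y: "solves (perturbed f g \<epsilon>) \<Omega> {t..} y" "y t = xs p \<alpha> \<epsilon> t"
      "\<And>\<tau>. t \<le> \<tau> \<Longrightarrow> norm (y \<tau> - xbar (\<tau> - t + p) \<alpha>) \<le> Ks * \<epsilon>"
      using ys \<epsilon> by force
    \<comment> \<open>Reversed times \<open>s \<le> - p\<close> correspond to the true times from
      \<open>t\<close> on.\<close>
    have "((\<lambda>s. y (- s + t - p)) has_vector_derivative
        (- 1) *\<^sub>R (f (y (- s + t - p)) + \<epsilon> *\<^sub>R G (y (- s + t - p)) (- s))) (at s within {..- p})" if "s \<le> - p" for s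
    proof (rule has_vector_derivative_reparametrized)
      show "((\<lambda>s. - s + t - p) has_real_derivative - 1) (at s within {..- p})"
        by (auto intro!: derivative_eq_intros)
      show "(y has_vector_derivative f (y (- s + t - p)) + \<epsilon> *\<^sub>R G (y (- s + t - p)) (- s)) (at (- s + t - p) within {t..})"
        using y(1) that unfolding solves_def perturbed_def G_def by auto
    qed auto
    moreover have "norm (y (- s + t - p) - xbar (- s) \<alpha>) \<le> Ks * \<epsilon>" "y (- s + t - p) \<in> \<Omega>" if "s \<le> - p" for s
      using y(3)[of "- s + t - p"] y(1) that by (simp_all add: solves_def)
    ultimately show ?thesis
      using y(2) by (intro exI[of _ "\<lambda>s. y (- s + t - p)"]) simp
  qed
  \<comment> \<open>The stable side is the unstable side of the time-reversed system.\<close>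
  have rf': "((\<lambda>x. - f x) has_derivative (- f' x)) (at x)" if "x \<in> \<Omega>" for x
    using has_derivative_minus[OF f'[OF that]] by (simp add: uminus_blinfun.rep_eq)
  have rf'': "((\<lambda>x. - f' x) has_derivative (- f'' x)) (at x)" if "x \<in> \<Omega>" for x
    using has_derivative_minus[OF f''[OF that]] by (simp add: uminus_blinfun.rep_eq)
  have rcont: "continuous_on \<Omega> (\<lambda>x. - f'' x)" by (intro continuous_intros cont)
  have rspec: "one_neg_two_pos_spectrum (jacobian (\<lambda>x. - f x) (at b))"
    unfolding jacobian_uminus[OF f'[OF fixed_points(2)]]
    by (rule one_neg_two_pos_spectrum_uminus[OF spectrum_b])
  have rbij: "bij_betw (\<lambda>(s, \<alpha>). xbar (- s) \<alpha>) (UNIV \<times> {0..<1}) (\<Gamma> - {b, a})"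
  proof -
    have "bij_betw (\<lambda>(s, \<alpha>). (- s, \<alpha>)) (UNIV \<times> {0..<1}) (UNIV \<times> {0..<1} :: (real \<times> real) set)"
      by (rule bij_betw_byWitness[where f'="\<lambda>(s, \<alpha>). (- s, \<alpha>)"]) auto
    from bij_betw_trans[OF this xbar_bij] show ?thesis
      by (simp add: o_def case_prod_unfold insert_commute)
  qed
  have rflow: "((\<lambda>s. xbar (- s) \<beta>) has_vector_derivative - f (xbar (- s) \<beta>)) (at s)" for s \<beta>
    by (rule has_vector_derivative_reflect[where y="\<lambda>s. xbar s \<beta>", OF xbar_flow])
  have rlim: "((\<lambda>s. xbar (- s) \<beta>) \<longlongrightarrow> b) at_bot" for \<beta>
    using xbar_b[of \<beta>] by (simp add: filterlim_at_bot_mirror)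
  have rX': "((\<lambda>(s, \<alpha>). xbar (- s) \<alpha>) has_derivative
      (\<lambda>(u, v). u *\<^sub>R (- f (xbar (- s) \<beta>)) + v *\<^sub>R Xa (- s) \<beta>)) (at (s, \<beta>))" for s \<beta>
  proof -
    have "((\<lambda>z. (\<lambda>(s, \<alpha>). xbar s \<alpha>) (- fst z, snd z)) has_derivative
        (\<lambda>w. (\<lambda>(u, v). u *\<^sub>R f (xbar (- s) \<beta>) + v *\<^sub>R Xa (- s) \<beta>) (- fst w, snd w))) (at (s, \<beta>))"
      by (rule has_derivative_compose[where g="\<lambda>(s, \<alpha>). xbar s \<alpha>"])
        (use X'[of "- s" \<beta>] in \<open>auto intro!: derivative_eq_intros\<close>)
    then show ?thesis by (simp add: case_prod_unfold)
  qed
  have rV: "((\<lambda>s. V (- s)) has_vector_derivative - V' (- s)) (at s)" for s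
    by (rule has_vector_derivative_reflect[OF V(1)])
  have rV': "- V' (- s) \<bullet> w = - (V (- s) \<bullet> (- f' (xbar (- s) \<alpha>)) w)" for s w
    by (simp add: V(2) uminus_blinfun.rep_eq)
  \<comment> \<open>Replacing \<open>f\<close> by \<open>- f\<close> flips the cross product; the
    weight \<open>- E\<close> compensates, so the same \<open>V\<close> is used, only read
    backward.\<close>
  have rV_eq: "V (- s) = (- E (- s)) *\<^sub>R cross3 (- f (xbar (- s) \<alpha>)) (Xa (- s) \<alpha>)" for s
    by (simp add: V_def)
  have rG': "((\<lambda>x. - G x (- s)) has_derivative (\<lambda>v. - (jacobian (\<lambda>y. g y (- s + t - p)) (at x) *v v))) (at x)"
    and rGL: "onorm (\<lambda>v. - (jacobian (\<lambda>y. g y (- s + t - p)) (at x) *v v)) \<le> L"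
    and rGB: "norm (- G x (- s)) \<le> B" if "x \<in> \<Omega>" for x s
    using has_derivative_minus[OF G'[OF that, of "- s"]] GL[OF that, of "- s"] GB[OF that, of "- s"]
    by (simp_all add: onorm_neg)
  note stable = one_sided_melnikov_expansion[where X="\<lambda>s. xbar (- s)" and Xa="\<lambda>s. Xa (- s)" and V="\<lambda>s. V (- s)"
      and V'="\<lambda>s. - V' (- s)" and e="\<lambda>s. - E (- s)" and G="\<lambda>x s. - G x (- s)" and p="- p"
      and f="\<lambda>x. - f x" and f'="\<lambda>x. - f' x" and f''="\<lambda>x. - f'' x",
      OF \<open>open \<Omega>\<close> fixed_points(2) rf' rf'' rcont rspec surf X\<Omega> xbar_periodic rbij rflow rlim
      fixed_points(3)[symmetric] rX' rV rV' rV_eq V_nz rG' rGL rGB \<epsilon>s Ys]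

  \<comment> \<open>Joining the two half-lines\<close>
  define J where "J = integral {..p} h"
  \<comment> \<open>Since the reversed forcing is \<open>- G\<close>, reflection makes this minus
    the integral of \<open>h\<close> over \<open>{p..}\<close>; hence the total is
    \<open>J - J'\<close>.\<close>
  define J' where "J' = integral {..- p} (\<lambda>s. V (- s) \<bullet> - G (xbar (- s) \<alpha>) (- s))"
  have J: "(h has_integral J) {..p}" unfolding J_def using unstable(1) by (rule integrable_integral)
  have "((\<lambda>s. V (- s) \<bullet> - G (xbar (- s) \<alpha>) (- s)) has_integral J') {..- p}"
    unfolding J'_def using stable(1) by (rule integrable_integral)
  from has_integral_neg[OF has_integral_reflect_set[OF this]]
  have "((\<lambda>s. - (V s \<bullet> - G (xbar s \<alpha>) s)) has_integral - J') (uminus ` {..- p})"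
    by (simp only: minus_minus)
  moreover have "uminus ` {..- p} = {p..}" by (auto intro: image_eqI[of _ _ "- x" for x])
  ultimately have J': "(h has_integral - J') {p..}" unfolding h_def by simp
  have M: "(h has_integral (J - J')) UNIV"
  proof -
    have "{..p} \<inter> {p..} = {p}" "{..p} \<union> {p..} = UNIV" by auto
    then show ?thesis using has_integral_Un[OF J J'] by simp
  qed
  define N where "N = surface_normal f xbar p \<alpha>"
  have N: "norm N > 0" unfolding N_def using normal_nonzero by simp
  obtain D1 where D1: "\<forall>\<^sub>F \<epsilon> in at_right 0. \<bar>N \<bullet> (xu p \<alpha> \<epsilon> t - xbar p \<alpha>) - \<epsilon> * J\<bar> \<le> D1 * \<epsilon>\<^sup>2"
    using unstable(2) unfolding J_def Vp N_def by blast
  obtain D2 where D2: "\<forall>\<^sub>F \<epsilon> in at_right 0. \<bar>N \<bullet> (xs p \<alpha> \<epsilon> t - xbar p \<alpha>) - \<epsilon> * J'\<bar> \<le> D2 * \<epsilon>\<^sup>2"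
    using stable(2) unfolding J'_def Vp N_def minus_minus by blast
  have "\<forall>\<^sub>F \<epsilon> in at_right 0. norm (normal_distance f xbar xu xs p \<alpha> \<epsilon> t - \<epsilon> * ((J - J') / norm N))
      \<le> ((D1 + D2) / norm N) * norm (\<epsilon>\<^sup>2)"
    using D1 D2
  proof eventually_elim
    case (elim \<epsilon>)
    \<comment> \<open>The unperturbed point \<open>xbar p \<alpha>\<close> drops out of the
      difference, leaving the normal component of the gap between the two perturbed points.\<close>
    let ?A = "N \<bullet> (xu p \<alpha> \<epsilon> t - xbar p \<alpha>) - \<epsilon> * J" and ?B = "N \<bullet> (xs p \<alpha> \<epsilon> t - xbar p \<alpha>) - \<epsilon> * J'"
    have "normal_distance f xbar xu xs p \<alpha> \<epsilon> t - \<epsilon> * ((J - J') / norm N) = (?A - ?B) / norm N"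
      unfolding normal_distance_def N_def[symmetric]
      by (simp add: inner_diff_right divide_inverse algebra_simps)
    moreover have "\<bar>?A - ?B\<bar> \<le> (D1 + D2) * \<epsilon>\<^sup>2"
      using elim abs_triangle_ineq4[of ?A ?B] by (simp add: distrib_right)
    ultimately show ?case using N by (simp add: divide_right_mono)
  qed
  then have "(\<lambda>\<epsilon>. normal_distance f xbar xu xs p \<alpha> \<epsilon> t - \<epsilon> * ((J - J') / norm N)) \<in> O[at_right 0](\<lambda>\<epsilon>. \<epsilon>\<^sup>2)"
    by (rule bigoI)
  moreover have "melnikov f g xbar p \<alpha> t = J - J'"
    unfolding melnikov_def h using M by (rule integral_unique)
  ultimately show "melnikov_integrand f g xbar p \<alpha> t integrable_on UNIV \<and>
           (\<lambda>\<epsilon>. normal_distance f xbar xu xs p \<alpha> \<epsilon> t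
                 - \<epsilon> * (melnikov f g xbar p \<alpha> t / norm (surface_normal f xbar p \<alpha>)))
             \<in> O[at_right 0](\<lambda>\<epsilon>. \<epsilon>\<^sup>2)"
    unfolding h N_def[symmetric] using M by auto
qed

end
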